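(* Let $n\ge 1$, let $\boldsymbol\alpha=(\alpha_1,\dots,\alpha_n)\in\mathbb{R}^n$ with $\alpha_k\notin\pi\mathbb{Z}$ for $k=1,\dots,n$, and let $1\le j\le n$. Then the $j$th fractional Riesz transform $R_j^{\boldsymbol\alpha}$ is given on the fractional Fourier transform side by multiplication by the function $-i\,\tilde u_j/|\tilde{\boldsymbol u}|$; that is, for every $f\in S(\mathbb{R}^n)$, $$\mathcal{F}_{\boldsymbol\alpha}\big(R_j^{\boldsymbol\alpha}f\big)(\boldsymbol u)=-i\,\frac{\tilde u_j}{|\tilde{\boldsymbol u}|}\,\mathcal{F}_{\boldsymbol\alpha}(f)(\boldsymbol u)$$ for a.e. $\boldsymbol u=(u_1,\dots,u_n)\in\mathbb{R}^n$, where $\tilde{\boldsymbol u}=(\tilde u_1,\dots,\tilde u_n)=(u_1\csc\alpha_1,\dots,u_n\csc\alpha_n)$.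
   Context: $S(\mathbb{R}^n)$ is the Schwartz class. For $\boldsymbol\alpha\in\mathbb{R}^n$ with all $\alpha_k\notin\pi\mathbb{Z}$, the chirp is $e_{\boldsymbol\alpha}(\boldsymbol x)=\exp\big(\tfrac{i}{2}\sum_{k=1}^n x_k^2\cot\alpha_k\big)$, so that $e_{-\boldsymbol\alpha}=1/e_{\boldsymbol\alpha}$. The multidimensional fractional Fourier transform (FRFT) of $f\in L^1(\mathbb{R}^n)$ is $$\mathcal{F}_{\boldsymbol\alpha}(f)(\boldsymbol u)=\frac{c(\boldsymbol\alpha)}{(\sqrt{2\pi})^n}\,e_{\boldsymbol\alpha}(\boldsymbol u)\int_{\mathbb{R}^n}f(\boldsymbol x)e_{\boldsymbol\alpha}(\boldsymbol x)e^{-i\sum_{k=1}^n x_ku_k\csc\alpha_k}\,d\boldsymbol x,\qquad c(\boldsymbol\alpha)=\prod_{k=1}^n\sqrt{1-i\cot\alpha_k}$$ (principal square root), and it is extended to $L^2(\mathbb{R}^n)$ by continuity from $L^1\cap L^2$. The $j$th fractional Riesz transform of $f\in S(\mathbb{R}^n)$ is $$R_j^{\boldsymbol\alpha}(f)(\boldsymbol x)=c_n\,e_{-\boldsymbol\alpha}(\boldsymbol x)\ \mathrm{p.v.}\int_{\mathbb{R}^n}\frac{x_j-y_j}{|\boldsymbol x-\boldsymbol y|^{n+1}}f(\boldsymbol y)e_{\boldsymbol\alpha}(\boldsymbol y)\,d\boldsymbol y,\qquad c_n=\frac{\Gamma(\frac{n+1}{2})}{\pi^{\frac{n+1}{2}}},$$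 where the principal value is the limit as $\varepsilon\to0^+$ of the integral over $|\boldsymbol x-\boldsymbol y|\ge\varepsilon$. *)

theory Defs
  imports "HOL-Analysis.Analysis"
begin

definition csc :: "real \<Rightarrow> real"
  where "csc t = 1 / sin t"

definition partial_deriv :: "'n::finite \<Rightarrow> (real^'n \<Rightarrow> complex) \<Rightarrow> real^'n \<Rightarrow> complex"
  where "partial_deriv k f x = vector_derivative (\<lambda>t. f (x + t *\<^sub>R axis k 1)) (at 0)"

definition iter_partial_deriv :: "'n::finite list \<Rightarrow> (real^'n \<Rightarrow> complex) \<Rightarrow> real^'n \<Rightarrow> complex"
  where "iter_partial_deriv ks f = foldr partial_deriv ks f"

text \<open>
  Derivatives of order \<open>m\<close> are indexed by lists of \<open>m\<close> coordinates. That every iterated partial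
  derivative is Frechet differentiable is the same as all of them existing and being continuous,
  i.e. smoothness; the order of the list is then irrelevant.
\<close>

definition schwartz :: "(real^'n::finite \<Rightarrow> complex) \<Rightarrow> bool"
  where "schwartz f \<longleftrightarrow>
    (\<forall>ks x. iter_partial_deriv ks f differentiable (at x)) \<and>
    (\<forall>ks (\<beta>::'n \<Rightarrow> nat).
      bounded (range (\<lambda>x. complex_of_real (\<Prod>k\<in>UNIV. (x $ k) ^ \<beta> k) * iter_partial_deriv ks f x)))"

definition chirp :: "real^'n::finite \<Rightarrow> real^'n \<Rightarrow> complex"
  where "chirp \<alpha> x = exp (\<i> / 2 * complex_of_real (\<Sum>k\<in>UNIV. (x $ k)\<^sup>2 * cot (\<alpha> $ k)))"

definition frft_const :: "real^'n::finite \<Rightarrow> complex"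
  where "frft_const \<alpha> = (\<Prod>k\<in>UNIV. csqrt (1 - \<i> * complex_of_real (cot (\<alpha> $ k))))"

definition frft_L1 :: "real^'n::finite \<Rightarrow> (real^'n \<Rightarrow> complex) \<Rightarrow> real^'n \<Rightarrow> complex"
  where "frft_L1 \<alpha> f u =
    frft_const \<alpha> / complex_of_real (sqrt (2 * pi) ^ CARD('n)) * chirp \<alpha> u *
    (LINT x|lebesgue. f x * chirp \<alpha> x *
       exp (- \<i> * complex_of_real (\<Sum>k\<in>UNIV. x $ k * u $ k * csc (\<alpha> $ k))))"

definition square_integrable :: "(real^'n::finite \<Rightarrow> complex) \<Rightarrow> bool"
  where "square_integrable f \<longleftrightarrow>
    f \<in> borel_measurable lebesgue \<and> integrable lebesgue (\<lambda>x. (cmod (f x))\<^sup>2)"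

definition L2_tendsto :: "(nat \<Rightarrow> real^'n::finite \<Rightarrow> complex) \<Rightarrow> (real^'n \<Rightarrow> complex) \<Rightarrow> bool"
  where "L2_tendsto h f \<longleftrightarrow>
    (\<lambda>m. \<integral>\<^sup>+ x. ennreal ((cmod (h m x - f x))\<^sup>2) \<partial>lebesgue) \<longlonglongrightarrow> 0"

text \<open>
  Extension by continuity from \<open>L\<^sup>1 \<inter> L\<^sup>2\<close>: \<open>g\<close> is the \<open>L\<^sup>2\<close> limit of the transforms of a sequence
  from \<open>L\<^sup>1 \<inter> L\<^sup>2\<close> that tends to \<open>f\<close> in \<open>L\<^sup>2\<close>. Elements of \<open>L\<^sup>2\<close> are represented by functions, so \<open>g\<close>
  is determined only up to a null set, and \<open>frft_L2\<close> picks one representative.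
\<close>

definition is_frft_L2 :: "real^'n::finite \<Rightarrow> (real^'n \<Rightarrow> complex) \<Rightarrow> (real^'n \<Rightarrow> complex) \<Rightarrow> bool"
  where "is_frft_L2 \<alpha> f g \<longleftrightarrow>
    square_integrable f \<and> square_integrable g \<and>
    (\<exists>h. (\<forall>m. integrable lebesgue (h m) \<and> square_integrable (h m)) \<and>
         L2_tendsto h f \<and> L2_tendsto (\<lambda>m. frft_L1 \<alpha> (h m)) g)"

definition frft_L2 :: "real^'n::finite \<Rightarrow> (real^'n \<Rightarrow> complex) \<Rightarrow> real^'n \<Rightarrow> complex"
  where "frft_L2 \<alpha> f = (SOME g. is_frft_L2 \<alpha> f g)"

definition frft :: "real^'n::finite \<Rightarrow> (real^'n \<Rightarrow> complex) \<Rightarrow> real^'n \<Rightarrow> complex"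
  where "frft \<alpha> f = (if integrable lebesgue f then frft_L1 \<alpha> f else frft_L2 \<alpha> f)"

definition riesz_const :: "nat \<Rightarrow> real"
  where "riesz_const n = Gamma ((real n + 1) / 2) / pi powr ((real n + 1) / 2)"

definition frac_riesz :: "'n::finite \<Rightarrow> real^'n \<Rightarrow> (real^'n \<Rightarrow> complex) \<Rightarrow> real^'n \<Rightarrow> complex"
  where "frac_riesz j \<alpha> f x =
    complex_of_real (riesz_const CARD('n)) * chirp (- \<alpha>) x *
    Lim (at_right 0) (\<lambda>\<epsilon>. LINT y:{y. \<epsilon> \<le> norm (x - y)}|lebesgue.
      complex_of_real ((x $ j - y $ j) / norm (x - y) ^ (CARD('n) + 1)) * f y * chirp \<alpha> y)"

definition csc_scale :: "real^'n::finite \<Rightarrow> real^'n \<Rightarrow> real^'n"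
  where "csc_scale \<alpha> u = (\<chi> k. u $ k * csc (\<alpha> $ k))"

end

theory Submission
  imports Defs "HOL-Probability.Characteristic_Functions" "HOL-Probability.Sinc_Integral"
    "HOL-Real_Asymp.Real_Asymp"
begin

text \<open>
Write \<open>g = f e\<^sub>\<alpha>\<close>. The chirps cancel on both sides: \<open>R\<^sub>j\<^sup>\<alpha> f = e\<^sub>-\<^sub>\<alpha> R\<^sub>j g\<close> with the classical Riesz
transform \<open>R\<^sub>j\<close>, and the fractional Fourier transform of \<open>h\<close> at \<open>u\<close> is a constant times
\<open>e\<^sub>\<alpha>(u)\<close> times the ordinary Fourier transform of \<open>h e\<^sub>\<alpha>\<close> at the rescaled point
\<open>csc_scale \<alpha> u\<close>. So the claim is that \<open>R\<^sub>j\<close> is the Fourier multiplier \<open>-i \<xi>\<^sub>j / |\<xi>|\<close>, read on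
\<open>L\<^sup>2\<close> because \<open>R\<^sub>j g\<close> need not be integrable.

That multiplier is found by writing the kernel as a superposition of Gaussians. By Euler's
integral, with \<open>p = (n + 1) / 2\<close>,
\<open>c\<^sub>n y\<^sub>j / |y|^(n+1) = \<pi>^(-p) \<integral>\<^sub>0\<^sup>\<infinity> t^(p-1) y\<^sub>j exp (-t |y|\<^sup>2) dt\<close>.
Restricting \<open>t\<close> to \<open>[1/r, r]\<close> gives an integrable kernel \<open>K\<^sub>r\<close> whose Fourier transform, computed
under the integral sign, is again an integral of this kind after \<open>t \<mapsto> 1/t\<close>
(\<open>fourier_riesz_trunc\<close>). It is bounded by 1 and tends to \<open>-i \<xi>\<^sub>j / |\<xi>|\<close> as \<open>r \<rightarrow> \<infinity>\<close>. Hence the Fourier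
transforms of the integrable functions \<open>K\<^sub>r * g\<close> converge in \<open>L\<^sup>2\<close> to the multiplier applied to
the Fourier transform of \<open>g\<close>.

It remains to see that \<open>K\<^sub>r * g\<close> itself converges in \<open>L\<^sup>2\<close> to \<open>R\<^sub>j g\<close>. Pointwise convergence follows
from dominated convergence: the kernels are odd, so \<open>g (x - y)\<close> may be replaced by
\<open>g (x - y) - g x\<close> on the unit ball, where the singularity becomes integrable
(\<open>convol_riesz_trunc_tendsto\<close>, \<open>riesz_principal_value\<close>). By Plancherel the sequence is Cauchy in
\<open>L\<^sup>2\<close>, and Fatou's lemma identifies the limit (\<open>convol_riesz_trunc_L2\<close>). Plancherel is split into an inequality for all integrable functions, which
also makes the \<open>L\<^sup>2\<close> extension of the fractional transform unique up to null sets
(\<open>is_frft_L2_unique\<close>), and the reverse inequality for bounded continuous ones.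
\<close>

section \<open>Gaussians and their Fourier transforms\<close>

lemma borel_measurable_cis [measurable]: "cis \<in> borel_measurable borel"
  by (intro borel_measurable_continuous_onI continuous_intros)

lemma borel_measurable_cnj [measurable]: "cnj \<in> borel_measurable borel"
  by (intro borel_measurable_continuous_onI continuous_intros)

text \<open>
Lebesgue measure is the image of a product measure under the coordinate map, so integrands that
split along the coordinates factor.
\<close>

lemma
  fixes F :: "'a::euclidean_space \<Rightarrow> real \<Rightarrow> complex"
  assumes F: "\<And>b. b \<in> Basis \<Longrightarrow> integrable lborel (F b)"
  shows integrable_lborel_prod: "integrable lborel (\<lambda>x::'a. \<Prod>b\<in>Basis. F b (x \<bullet> b))"
    and integral_lborel_prod:
      "(LINT x|lborel. (\<Prod>b\<in>Basis. F b (x \<bullet> b))) = (\<Prod>b\<in>Basis. (LINT t|lborel. F b t))"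
proof -
  interpret product_sigma_finite "\<lambda>_::'a. lborel :: real measure" ..
  let ?T = "\<lambda>f. \<Sum>b\<in>Basis. f b *\<^sub>R (b::'a)"
  have T [measurable]: "?T \<in> (\<Pi>\<^sub>M b\<in>Basis. lborel) \<rightarrow>\<^sub>M borel"
    by measurable
  have [measurable]: "(\<lambda>x::'a. \<Prod>b\<in>Basis. F b (x \<bullet> b)) \<in> borel_measurable borel"
    using F[THEN borel_measurable_integrable] by (intro borel_measurable_prod) simp
  have eq: "(\<Prod>b\<in>Basis. F b (?T f \<bullet> b)) = (\<Prod>b\<in>Basis. F b (f b))" for f
    by (intro prod.cong refl arg_cong2[of _ _ _ _ F]) (simp add: inner_sum_left inner_Basis if_distrib cong: if_cong)
  show "integrable lborel (\<lambda>x::'a. \<Prod>b\<in>Basis. F b (x \<bullet> b))"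
    by (subst lborel_eq, subst integrable_distr_eq[OF T]) (simp_all only: eq, simp, intro product_integrable_prod, simp_all add: F)
  show "(LINT x|lborel. (\<Prod>b\<in>Basis. F b (x \<bullet> b))) = (\<Prod>b\<in>Basis. (LINT t|lborel. F b t))"
    by (subst lborel_eq, subst integral_distr[OF T]) (simp_all only: eq, simp, intro product_integral_prod, simp_all add: F)
qed

lemma integrable_exp_minus_square:
  assumes a: "a > 0"
  shows "integrable lborel (\<lambda>x::real. exp (- a * x\<^sup>2))"
    and "integrable lborel (\<lambda>x::real. x * exp (- a * x\<^sup>2))"
proof -
  define s where "s = 1 / sqrt (2 * a)"
  have s: "s\<^sup>2 = 1 / (2 * a)" "s > 0" using a by (auto simp: s_def power_divide)
  define c where "c = sqrt (2 * pi * s\<^sup>2)"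
  have c: "c > 0" using s(2) by (simp add: c_def)
  have nd: "exp (- a * x\<^sup>2) = c * normal_density 0 s x" for x
    using c s(2) unfolding normal_density_def c_def[symmetric] by (simp add: s(1))
  show "integrable lborel (\<lambda>x::real. exp (- a * x\<^sup>2))"
    unfolding nd using integrable_normal_density[OF s(2)] by simp
  have "integrable lborel (\<lambda>x. c * (normal_density 0 s x * x))"
    using integrable_normal_moment_nz_1[OF s(2)] by simp
  then show "integrable lborel (\<lambda>x::real. x * exp (- a * x\<^sup>2))"
    unfolding nd by (simp add: mult_ac)
qed

lemma integral_gaussian_cis_real:
  assumes a: "a > 0"
  shows "(LINT x|lborel. complex_of_real (exp (- a * x\<^sup>2)) * cis (- (x * \<xi>)))
    = complex_of_real (sqrt (pi / a) * exp (- \<xi>\<^sup>2 / (4 * a)))"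
proof -
  define c where "c = sqrt (2 * a)"
  have c: "c > 0" "c\<^sup>2 = 2 * a" using a by (auto simp: c_def)
  define t where "t = - \<xi> / c"
  have "complex_of_real (exp (- t\<^sup>2 / 2)) = (CLINT x|std_normal_distribution. iexp (t * x))"
    using char_std_normal_distribution by (simp add: char_def fun_eq_iff)
  also have "\<dots> = (LINT x|lborel. std_normal_density x *\<^sub>R iexp (t * x))"
    by (subst integral_density) auto
  also have "\<dots> = c *\<^sub>R (LINT x|lborel. std_normal_density (0 + c * x) *\<^sub>R iexp (t * (0 + c * x)))"
    using c by (subst lborel_integral_real_affine[of c _ 0]) auto
  also have "(\<lambda>x. std_normal_density (0 + c * x) *\<^sub>R iexp (t * (0 + c * x))) =
      (\<lambda>x. complex_of_real (1 / sqrt (2 * pi)) * (complex_of_real (exp (- a * x\<^sup>2)) * cis (- (x * \<xi>))))"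
    using c a
    by (auto simp: std_normal_density_def fun_eq_iff cis_conv_exp scaleR_conv_of_real t_def power_mult_distrib field_simps)
  finally have "complex_of_real (exp (- t\<^sup>2 / 2)) = complex_of_real (c / sqrt (2 * pi)) *
      (LINT x|lborel. complex_of_real (exp (- a * x\<^sup>2)) * cis (- (x * \<xi>)))"
    by (simp add: scaleR_conv_of_real)
  moreover have "c / sqrt (2 * pi) * sqrt (pi / a) = 1"
    using a by (simp add: c_def real_sqrt_mult real_sqrt_divide)
  moreover have "t\<^sup>2 / 2 = \<xi>\<^sup>2 / (4 * a)"
    using c by (simp add: t_def power_divide)
  ultimately show ?thesis
    using c(1) by (simp add: field_simps)
qed

text \<open>
The derivative of \<open>exp (-a x\<^sup>2) cis (-x \<xi>)\<close> integrates to zero over the line, which expresses the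
first moment through the integral already known.
\<close>

lemma integral_moment_gaussian_cis_real:
  assumes a: "a > 0"
  shows "(LINT x|lborel. complex_of_real (x * exp (- a * x\<^sup>2)) * cis (- (x * \<xi>)))
    = - \<i> * complex_of_real (\<xi> / (2 * a)) * complex_of_real (sqrt (pi / a) * exp (- \<xi>\<^sup>2 / (4 * a)))"
proof -
  let ?G = "\<lambda>x. complex_of_real (exp (- a * x\<^sup>2)) * cis (- (x * \<xi>))"
  let ?H = "\<lambda>x. complex_of_real (x * exp (- a * x\<^sup>2)) * cis (- (x * \<xi>))"
  let ?f = "\<lambda>x. complex_of_real (- 2 * a) * ?H x - \<i> * complex_of_real \<xi> * ?G x"
  have iG: "integrable lborel ?G"
    by (rule Bochner_Integration.integrable_bound[OF integrable_exp_minus_square(1)[OF a]]) (auto simp: norm_mult)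
  have iH: "integrable lborel ?H"
    by (rule Bochner_Integration.integrable_bound[OF integrable_exp_minus_square(2)[OF a]]) (auto simp: norm_mult)
  have "(LBINT x=-\<infinity>..\<infinity>. ?f x) = 0 - 0"
  proof (rule interval_integral_FTC_integrable[where F = ?G])
    show "(?G has_vector_derivative ?f x) (at x)" for x
      unfolding cis_conv_exp
      by (auto intro!: derivative_eq_intros simp: has_vector_derivative_complex_iff Re_exp Im_exp power2_eq_square algebra_simps)
    have "filterlim (\<lambda>x::real. a * x\<^sup>2) at_top at_top" "filterlim (\<lambda>x::real. a * x\<^sup>2) at_top at_bot"
      using a by real_asymp+
    then have *: "((\<lambda>x. exp (- a * x\<^sup>2)) \<longlongrightarrow> 0) F" if "F = at_top \<or> F = at_bot" for F
      using that by (auto intro!: filterlim_compose[OF exp_at_bot] simp: filterlim_uminus_at_top[symmetric])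
    have **: "(?G \<longlongrightarrow> 0) F" if "F = at_top \<or> F = at_bot" for F
      by (rule tendsto_norm_zero_cancel) (use *[OF that] in \<open>simp add: norm_mult\<close>)
    show "((?G \<circ> real_of_ereal) \<longlongrightarrow> 0) (at_right (-\<infinity>))"
      using ** by (simp add: ereal_tendsto_simps1)
    show "((?G \<circ> real_of_ereal) \<longlongrightarrow> 0) (at_left \<infinity>)"
      using ** by (simp add: ereal_tendsto_simps1)
  qed (use iG iH in \<open>auto simp: set_integrable_def cis_conv_exp intro!: continuous_intros\<close>)
  then have "0 = (LINT x|lborel. ?f x)"
    by (simp add: interval_lebesgue_integral_def einterval_def set_lebesgue_integral_def)
  also have "\<dots> = complex_of_real (- 2 * a) * (LINT x|lborel. ?H x) - \<i> * complex_of_real \<xi> * (LINT x|lborel. ?G x)"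
    by (subst Bochner_Integration.integral_diff) (use iG iH in auto)
  finally show ?thesis
    using a unfolding integral_gaussian_cis_real[OF a] by (simp add: field_simps)
qed

text \<open>
The factor \<open>(2 \<pi>)^(-n/2)\<close> is left out, so that Plancherel carries the constant \<open>(2 \<pi>)^n\<close> and
convolutions are mapped to products without a constant.
\<close>

definition fourier :: "('a::euclidean_space \<Rightarrow> complex) \<Rightarrow> 'a \<Rightarrow> complex"
  where "fourier h \<xi> = (LINT x|lborel. h x * cis (- (x \<bullet> \<xi>)))"

lemma integrable_times_cis:
  assumes "integrable lborel h"
  shows "integrable lborel (\<lambda>x::'a::euclidean_space. h x * cis (x \<bullet> \<xi>))"
proof -
  note [measurable] = borel_measurable_integrable[OF assms]
  show ?thesis
    by (rule Bochner_Integration.integrable_bound[OF assms]) (auto simp: norm_mult)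
qed

lemma norm_square_Basis: "(norm (x::'a::euclidean_space))\<^sup>2 = (\<Sum>b\<in>Basis. (x \<bullet> b)\<^sup>2)"
  unfolding power2_norm_eq_inner by (subst euclidean_inner) (simp add: power2_eq_square)

lemma exp_norm_square_prod: 
  "exp (- a * (norm (x::'a::euclidean_space))\<^sup>2) = (\<Prod>b\<in>Basis. exp (- a * (x \<bullet> b)\<^sup>2))"
  by (simp add: norm_square_Basis sum_distrib_left exp_sum flip: sum_negf)

lemma cis_inner_prod: 
  "cis (- (x \<bullet> (\<xi>::'a::euclidean_space))) = (\<Prod>b\<in>Basis. cis (- ((x \<bullet> b) * (\<xi> \<bullet> b))))"
  by (simp add: euclidean_inner[of x \<xi>] cis_conv_exp exp_sum sum_distrib_left flip: sum_negf)

lemma integrable_gaussian: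
  assumes a: "a > 0"
  shows "integrable lborel (\<lambda>x::'a::euclidean_space. exp (- a * (norm x)\<^sup>2))"
proof -
  have "integrable lborel (\<lambda>x::'a. \<Prod>b\<in>Basis. complex_of_real (exp (- a * (x \<bullet> b)\<^sup>2)))"
    using integrable_exp_minus_square(1)[OF a] by (intro integrable_lborel_prod) (simp del: of_real_exp)
  then show ?thesis
    unfolding exp_norm_square_prod of_real_prod[symmetric] by (simp only: complex_of_real_integrable_eq)
qed

lemma fourier_gaussian:
  assumes a: "a > 0"
  shows "fourier (\<lambda>x::'a::euclidean_space. complex_of_real (exp (- a * (norm x)\<^sup>2))) \<xi>
    = complex_of_real (sqrt (pi / a) ^ DIM('a) * exp (- (norm \<xi>)\<^sup>2 / (4 * a)))"
proof -
  have "fourier (\<lambda>x::'a. complex_of_real (exp (- a * (norm x)\<^sup>2))) \<xi> =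
     (LINT x|lborel. (\<Prod>b\<in>Basis. complex_of_real (exp (- a * (x \<bullet> b)\<^sup>2)) * cis (- ((x \<bullet> b) * (\<xi> \<bullet> b)))))"
    unfolding fourier_def exp_norm_square_prod cis_inner_prod of_real_prod prod.distrib ..
  also have "\<dots> = (\<Prod>b\<in>Basis. (LINT t|lborel. complex_of_real (exp (- a * t\<^sup>2)) * cis (- (t * (\<xi> \<bullet> b)))))"
    by (intro integral_lborel_prod
       Bochner_Integration.integrable_bound[OF integrable_exp_minus_square(1)[OF a]]) (auto simp: norm_mult)
  also have "\<dots> = complex_of_real (\<Prod>b\<in>Basis. sqrt (pi / a) * exp (- (1 / (4 * a)) * (\<xi> \<bullet> b)\<^sup>2))"
    unfolding integral_gaussian_cis_real[OF a] of_real_prod by simp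
  also have "(\<Prod>b\<in>Basis. sqrt (pi / a) * exp (- (1 / (4 * a)) * (\<xi> \<bullet> b)\<^sup>2)) =
      sqrt (pi / a) ^ DIM('a) * exp (- (1 / (4 * a)) * (norm \<xi>)\<^sup>2)"
    unfolding exp_norm_square_prod prod.distrib by simp
  finally show ?thesis by simp
qed

lemma fourier_moment_gaussian:
  assumes a: "a > 0" and e: "e \<in> Basis"
  shows "integrable lborel (\<lambda>x::'a::euclidean_space. complex_of_real ((x \<bullet> e) * exp (- a * (norm x)\<^sup>2)))" (is ?I)
    and "fourier (\<lambda>x::'a. complex_of_real ((x \<bullet> e) * exp (- a * (norm x)\<^sup>2))) \<xi>
    = - \<i> * complex_of_real ((\<xi> \<bullet> e) / (2 * a) * sqrt (pi / a) ^ DIM('a) * exp (- (norm \<xi>)\<^sup>2 / (4 * a)))" (is ?F)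
proof -
  \<comment> \<open>The moment affects only the one-dimensional factor in direction e.\<close>
  let ?w = "\<lambda>b t. if b = e then t else 1"
  let ?f = "\<lambda>b t. complex_of_real (?w b t * exp (- a * t\<^sup>2))"
  have w: "complex_of_real ((x \<bullet> e) * exp (- a * (norm x)\<^sup>2)) = (\<Prod>b\<in>Basis. ?f b (x \<bullet> b))" for x :: 'a
    unfolding exp_norm_square_prod of_real_prod of_real_mult prod.distrib
    using e by (simp add: prod.If_cases prod.delta if_distrib[where f=of_real] cong: if_cong)
  have iF: "integrable lborel (?f b)" for b
    using integrable_exp_minus_square[OF a] by (cases "b = e") (simp_all del: of_real_exp of_real_mult)
  show ?I unfolding w by (intro integrable_lborel_prod iF)
  have "fourier (\<lambda>x::'a. complex_of_real ((x \<bullet> e) * exp (- a * (norm x)\<^sup>2))) \<xi> =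
     (LINT x|lborel. (\<Prod>b\<in>Basis. ?f b (x \<bullet> b) * cis (- ((x \<bullet> b) * (\<xi> \<bullet> b)))))"
    unfolding fourier_def w cis_inner_prod prod.distrib ..
  also have "\<dots> = (\<Prod>b\<in>Basis. (LINT t|lborel. ?f b t * cis (- (t * (\<xi> \<bullet> b)))))"
    by (intro integral_lborel_prod Bochner_Integration.integrable_bound[OF iF]) (auto simp: norm_mult)
  also have "\<dots> = (\<Prod>b\<in>Basis. (if b = e then - \<i> * complex_of_real ((\<xi> \<bullet> e) / (2 * a)) else 1) *
       complex_of_real (sqrt (pi / a) * exp (- (1 / (4 * a)) * (\<xi> \<bullet> b)\<^sup>2)))"
    using integral_gaussian_cis_real[OF a] integral_moment_gaussian_cis_real[OF a]
    by (intro prod.cong refl) simp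
  also have "\<dots> = - \<i> * complex_of_real ((\<xi> \<bullet> e) / (2 * a)) *
       complex_of_real (\<Prod>b\<in>Basis. sqrt (pi / a) * exp (- (1 / (4 * a)) * (\<xi> \<bullet> b)\<^sup>2))"
    unfolding prod.distrib of_real_prod using e by (simp add: prod.distrib)
  also have "(\<Prod>b\<in>Basis. sqrt (pi / a) * exp (- (1 / (4 * a)) * (\<xi> \<bullet> b)\<^sup>2)) =
      sqrt (pi / a) ^ DIM('a) * exp (- (1 / (4 * a)) * (norm \<xi>)\<^sup>2)"
    unfolding exp_norm_square_prod prod.distrib by simp
  finally show ?F by simp
qed

section \<open>Plancherel\<close>

lemma fatou_tendsto_bound:
  fixes u :: "nat \<Rightarrow> 'a \<Rightarrow> ennreal"
  assumes "\<And>i. u i \<in> borel_measurable M"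
    and lim: "\<And>x. x \<in> space M \<Longrightarrow> (\<lambda>i. u i x) \<longlonglongrightarrow> v x"
    and le: "\<And>i. (\<integral>\<^sup>+x. u i x \<partial>M) \<le> C i" and C: "C \<longlonglongrightarrow> c"
  shows "(\<integral>\<^sup>+x. v x \<partial>M) \<le> c"
proof -
  have "(\<integral>\<^sup>+x. v x \<partial>M) = (\<integral>\<^sup>+x. liminf (\<lambda>i. u i x) \<partial>M)"
    by (intro nn_integral_cong) (simp add: lim_imp_Liminf[OF _ lim])
  also have "\<dots> \<le> liminf (\<lambda>i. \<integral>\<^sup>+x. u i x \<partial>M)"
    by (rule nn_integral_liminf) fact
  also have "\<dots> \<le> liminf C"
    by (intro Liminf_mono always_eventually allI le)
  also have "\<dots> = c"
    using C by (intro lim_imp_Liminf) auto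
  finally show ?thesis .
qed

lemma nn_integral_lborel_affine:
  fixes f :: "'a::euclidean_space \<Rightarrow> ennreal"
  assumes [measurable]: "f \<in> borel_measurable borel" and c: "c \<noteq> 0"
  shows "(\<integral>\<^sup>+x. f x \<partial>lborel) = ennreal (\<bar>c\<bar> ^ DIM('a)) * (\<integral>\<^sup>+x. f (t + c *\<^sub>R x) \<partial>lborel)"
  by (subst lborel_affine[OF c, of t])
     (simp add: nn_integral_density nn_integral_distr nn_integral_cmult)

lemma
  fixes f :: "'a::euclidean_space \<Rightarrow> 'b::{banach, second_countable_topology}"
  assumes [measurable]: "f \<in> borel_measurable borel" and c: "c \<noteq> 0"
  shows integral_lborel_affine:
      "(LINT x|lborel. f x) = \<bar>c\<bar> ^ DIM('a) *\<^sub>R (LINT x|lborel. f (t + c *\<^sub>R x))"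
    and integrable_lborel_affine: "integrable lborel f \<Longrightarrow> integrable lborel (\<lambda>x. f (t + c *\<^sub>R x))"
proof -
  show "(LINT x|lborel. f x) = \<bar>c\<bar> ^ DIM('a) *\<^sub>R (LINT x|lborel. f (t + c *\<^sub>R x))"
    by (subst lborel_affine[OF c, of t]) (simp add: integral_density integral_distr)
  show "integrable lborel (\<lambda>x. f (t + c *\<^sub>R x))" if "integrable lborel f"
    using that c unfolding integrable_iff_bounded
    by (subst (asm) nn_integral_lborel_affine[where c=c and t=t]) (auto simp: ennreal_mult_less_top)
qed

lemma integrable_pairI:
  fixes f :: "'a::euclidean_space \<Rightarrow> 'b::euclidean_space \<Rightarrow> complex"
  assumes [measurable]: "case_prod f \<in> borel_measurable (borel \<Otimes>\<^sub>M borel)"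
    and "(\<integral>\<^sup>+x. \<integral>\<^sup>+y. ennreal (norm (f x y)) \<partial>lborel \<partial>lborel) < \<infinity>"
  shows "integrable (lborel \<Otimes>\<^sub>M lborel) (case_prod f)"
proof (rule integrableI_bounded)
  have "(\<integral>\<^sup>+z. norm (case_prod f z) \<partial>(lborel \<Otimes>\<^sub>M lborel)) =
      (\<integral>\<^sup>+x. \<integral>\<^sup>+y. ennreal (norm (f x y)) \<partial>lborel \<partial>lborel)"
    by (subst lborel.nn_integral_fst[symmetric]) auto
  then show "(\<integral>\<^sup>+z. norm (case_prod f z) \<partial>(lborel \<Otimes>\<^sub>M lborel)) < \<infinity>"
    using assms by simp
qed simp

lemma measurable_fourier [measurable]:
  assumes [measurable]: "h \<in> borel_measurable borel"
  shows "fourier (h :: 'a::euclidean_space \<Rightarrow> complex) \<in> borel_measurable borel"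
  unfolding fourier_def[abs_def] by measurable

lemma integrable_borelD: "integrable lborel h \<Longrightarrow> h \<in> borel_measurable borel"
  using borel_measurable_integrable by fastforce

lemma integrable_tensor:
  fixes u :: "'a::euclidean_space \<Rightarrow> complex" and v :: "'b::euclidean_space \<Rightarrow> complex"
  assumes u: "integrable lborel u" and v: "integrable lborel v"
  shows "integrable (lborel \<Otimes>\<^sub>M lborel) (\<lambda>(x, y). u x * v y)"
proof -
  note [measurable] = integrable_borelD[OF u] integrable_borelD[OF v]
  show ?thesis using u v
    by (intro integrable_pairI)
      (auto simp: integrable_iff_bounded norm_mult ennreal_mult nn_integral_cmult nn_integral_multc ennreal_mult_less_top)
qed

lemma norm_fourier_le: "norm (fourier h \<xi>) \<le> (LINT x|lborel. norm (h x))"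
  unfolding fourier_def using integral_norm_bound[of lborel "\<lambda>x. h x * cis (- (x \<bullet> \<xi>))"] by (simp add: norm_mult)

text \<open>
The multiplication formula: both sides are the double integral of \<open>h x \<phi> \<xi> cis (-x \<bullet> \<xi>)\<close>.
\<close>

lemma integral_fourier_mult:
  fixes h \<phi> :: "'a::euclidean_space \<Rightarrow> complex"
  assumes h: "integrable lborel h" and \<phi>: "integrable lborel \<phi>"
  shows "(LINT \<xi>|lborel. fourier h \<xi> * \<phi> \<xi>) = (LINT x|lborel. h x * fourier \<phi> x)"
proof -
  note [measurable] = integrable_borelD[OF h] integrable_borelD[OF \<phi>]
  have fin: "(\<integral>\<^sup>+x. norm (h x) \<partial>lborel) < \<infinity>" "(\<integral>\<^sup>+x. norm (\<phi> x) \<partial>lborel) < \<infinity>"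
    using h \<phi> by (auto simp: integrable_iff_bounded)
  have "integrable (lborel \<Otimes>\<^sub>M lborel) (\<lambda>(x, \<xi>). h x * cis (- (x \<bullet> \<xi>)) * \<phi> \<xi>)"
    using fin by (intro integrable_pairI)
      (auto simp: norm_mult ennreal_mult nn_integral_cmult nn_integral_multc ennreal_mult_less_top)
  from lborel_pair.Fubini_integral[OF this] show ?thesis
    unfolding fourier_def
    by (simp add: mult.assoc inner_commute flip: integral_mult_left_zero integral_mult_right_zero)
       (simp add: mult_ac)
qed

text \<open>
The Fourier transform of \<open>exp (-a |\<xi>|\<^sup>2)\<close>; its total mass is \<open>(2 \<pi>)^n\<close> for every \<open>a\<close>, and it
concentrates at the origin as \<open>a \<rightarrow> 0\<close>.
\<close>

definition gauss_kernel :: "real \<Rightarrow> 'a::euclidean_space \<Rightarrow> real"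
  where "gauss_kernel a z = sqrt (pi / a) ^ DIM('a) * exp (- (norm z)\<^sup>2 / (4 * a))"

lemma gauss_kernel_nonneg: "a > 0 \<Longrightarrow> gauss_kernel a z \<ge> 0"
  by (simp add: gauss_kernel_def)

lemma measurable_gauss_kernel [measurable]: "gauss_kernel a \<in> borel_measurable borel"
  unfolding gauss_kernel_def[abs_def] by measurable

lemma integral_gaussian:
  assumes a: "a > 0"
  shows "(LINT x|lborel. exp (- a * (norm (x::'a::euclidean_space))\<^sup>2)) = sqrt (pi / a) ^ DIM('a)"
proof -
  have "complex_of_real (LINT x|lborel. exp (- a * (norm (x::'a))\<^sup>2)) = complex_of_real (sqrt (pi / a) ^ DIM('a))"
    using fourier_gaussian[OF a, of "0::'a"] by (simp add: fourier_def flip: integral_complex_of_real of_real_exp)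
  then show ?thesis by (simp only: of_real_eq_iff)
qed

lemma nn_integral_gauss_kernel:
  assumes a: "a > 0"
  shows "(\<integral>\<^sup>+z. gauss_kernel a (z::'a::euclidean_space) \<partial>lborel) = ennreal ((2 * pi) ^ DIM('a))"
proof -
  have a': "1 / (4 * a) > 0" using a by simp
  have k: "gauss_kernel a (z::'a) = sqrt (pi / a) ^ DIM('a) * exp (- (1 / (4 * a)) * (norm z)\<^sup>2)" for z
    by (simp add: gauss_kernel_def)
  have "(\<integral>\<^sup>+z. gauss_kernel a (z::'a) \<partial>lborel) = ennreal (LINT z|lborel. gauss_kernel a (z::'a))"
    unfolding k using integrable_gaussian[OF a', where 'a='a] a
    by (intro nn_integral_eq_integral) auto
  also have "(LINT z|lborel. gauss_kernel a (z::'a)) = (sqrt (pi / a) * sqrt (pi / (1 / (4 * a)))) ^ DIM('a)"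
    unfolding k using integral_gaussian[OF a', where 'a='a] by (simp add: power_mult_distrib)
  also have "sqrt (pi / a) * sqrt (pi / (1 / (4 * a))) = 2 * pi"
    using a by (simp add: real_sqrt_mult[symmetric])
       (rule real_sqrt_unique, auto simp: power2_eq_square)
  finally show ?thesis .
qed

text \<open>
The identity behind both halves of Plancherel. The Gaussian weight makes all integrals absolutely
convergent, and the multiplication formula, applied once to each of the two factors of
\<open>|fourier h|\<^sup>2\<close>, moves the transforms onto the weight.
\<close>

lemma integral_fourier_gaussian:
  fixes h :: "'a::euclidean_space \<Rightarrow> complex"
  assumes h: "integrable lborel h" and a: "a > 0"
  shows "complex_of_real (LINT \<xi>|lborel. (cmod (fourier h \<xi>))\<^sup>2 * exp (- a * (norm \<xi>)\<^sup>2)) =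
    (LINT x|lborel. h x * cnj (LINT y|lborel. h y * gauss_kernel a (y - x)))"
proof -
  note [measurable] = integrable_borelD[OF h]
  define e where "e = (\<lambda>\<xi>::'a. complex_of_real (exp (- a * (norm \<xi>)\<^sup>2)))"
  have [measurable]: "e \<in> borel_measurable borel" unfolding e_def by measurable
  have ie: "integrable lborel e"
    unfolding e_def complex_of_real_integrable_eq by (rule integrable_gaussian[OF a])
  define \<phi> where "\<phi> = (\<lambda>\<xi>. cnj (fourier h \<xi>) * e \<xi>)"
  have [measurable]: "\<phi> \<in> borel_measurable borel" unfolding \<phi>_def by measurable
  have i\<phi>: "integrable lborel \<phi>"
  proof (rule Bochner_Integration.integrable_bound)
    show "integrable lborel (\<lambda>\<xi>. complex_of_real (LINT x|lborel. norm (h x)) * e \<xi>)"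
      using ie by simp
    show "AE \<xi> in lborel. norm (\<phi> \<xi>) \<le> norm (complex_of_real (LINT x|lborel. norm (h x)) * e \<xi>)"
      unfolding \<phi>_def norm_mult using norm_fourier_le[of h] by (auto intro!: mult_right_mono order.trans[OF _ abs_ge_self])
  qed simp
  have F\<phi>: "fourier \<phi> x = cnj (LINT y|lborel. h y * gauss_kernel a (y - x))" for x
  proof -
    let ?\<psi> = "\<lambda>\<xi>. e \<xi> * cis (\<xi> \<bullet> x)"
    have "fourier \<phi> x = cnj (LINT \<xi>|lborel. fourier h \<xi> * ?\<psi> \<xi>)"
      unfolding fourier_def[of \<phi>] unfolding \<phi>_def
      by (subst Bochner_Integration.integral_cnj[symmetric]) (simp add: cis_cnj e_def mult_ac)
    also have "(LINT \<xi>|lborel. fourier h \<xi> * ?\<psi> \<xi>) = (LINT y|lborel. h y * fourier ?\<psi> y)"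
      by (intro integral_fourier_mult h integrable_times_cis ie)
    also have "fourier ?\<psi> = (\<lambda>y. complex_of_real (gauss_kernel a (y - x)))"
    proof
      fix y
      have "fourier ?\<psi> y = fourier e (y - x)"
        unfolding fourier_def by (simp add: mult.assoc cis_mult inner_diff_right)
      then show "fourier ?\<psi> y = gauss_kernel a (y - x)"
        using fourier_gaussian[OF a, of "y - x"] by (simp add: e_def gauss_kernel_def)
    qed
    finally show ?thesis .
  qed
  have "complex_of_real (LINT \<xi>|lborel. (cmod (fourier h \<xi>))\<^sup>2 * exp (- a * (norm \<xi>)\<^sup>2)) =
     (LINT \<xi>|lborel. fourier h \<xi> * \<phi> \<xi>)"
    unfolding \<phi>_def e_def integral_complex_of_real[symmetric] mult.assoc[symmetric]
    by (simp add: complex_norm_square flip: of_real_power)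
  also have "\<dots> = (LINT x|lborel. h x * fourier \<phi> x)"
    by (rule integral_fourier_mult[OF h i\<phi>])
  finally show ?thesis unfolding F\<phi> .
qed

lemma integrable_fourier_gaussian:
  fixes h :: "'a::euclidean_space \<Rightarrow> complex"
  assumes h: "integrable lborel h" and a: "a > 0"
  shows "integrable lborel (\<lambda>\<xi>. (cmod (fourier h \<xi>))\<^sup>2 * exp (- a * (norm \<xi>)\<^sup>2))"
proof (rule Bochner_Integration.integrable_bound)
  note [measurable] = integrable_borelD[OF h]
  show "integrable lborel (\<lambda>\<xi>::'a. (LINT x|lborel. norm (h x))\<^sup>2 * exp (- a * (norm \<xi>)\<^sup>2))"
    by (intro integrable_mult_right integrable_gaussian[OF a])
  show "AE \<xi> in lborel. norm ((cmod (fourier h \<xi>))\<^sup>2 * exp (- a * (norm \<xi>)\<^sup>2)) \<le>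
      norm ((LINT x|lborel. norm (h x))\<^sup>2 * exp (- a * (norm \<xi>)\<^sup>2))"
    using norm_fourier_le[of h] by (auto intro!: power_mono)
qed (use integrable_borelD[OF h] in measurable)

lemma tendsto_exp_minus_inverse_Suc:
  "(\<lambda>m. exp (- inverse (real (Suc m)) * c)) \<longlonglongrightarrow> 1"
proof -
  have "(\<lambda>m. exp (- inverse (real (Suc m)) * c)) \<longlonglongrightarrow> exp (- 0 * c)"
    by (intro tendsto_intros LIMSEQ_inverse_real_of_nat)
  then show ?thesis by simp
qed

text \<open>
In the weighted identity, \<open>|h x| |h y| \<le> (|h x|\<^sup>2 + |h y|\<^sup>2) / 2\<close> and the mass \<open>(2 \<pi>)^n\<close> of the kernel
bound the right-hand side by \<open>(2 \<pi>)^n\<close> times the square norm of \<open>h\<close>, uniformly in the weight,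
which Fatou's lemma then removes. The square norm of \<open>h\<close> may be infinite.
\<close>

lemma plancherel_le:
  fixes h :: "'a::euclidean_space \<Rightarrow> complex"
  assumes h: "integrable lborel h"
  shows "(\<integral>\<^sup>+\<xi>. (cmod (fourier h \<xi>))\<^sup>2 \<partial>lborel) \<le> ennreal ((2 * pi) ^ DIM('a)) * (\<integral>\<^sup>+x. (cmod (h x))\<^sup>2 \<partial>lborel)"
proof -
  note [measurable] = integrable_borelD[OF h]
  let ?N = "ennreal ((2 * pi) ^ DIM('a))"
  let ?Q = "\<integral>\<^sup>+x. (cmod (h x))\<^sup>2 \<partial>lborel"
  have bound: "(\<integral>\<^sup>+\<xi>. (cmod (fourier h \<xi>))\<^sup>2 * exp (- a * (norm \<xi>)\<^sup>2) \<partial>lborel) \<le> ?N * ?Q"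
    if a: "a > 0" for a
  proof -
    define g :: "'a \<Rightarrow> real" where "g = gauss_kernel a"
    have g0: "g z \<ge> 0" for z :: 'a by (simp add: g_def gauss_kernel_nonneg a)
    have [measurable]: "g \<in> borel_measurable borel" by (simp add: g_def)
    have tr1: "(\<integral>\<^sup>+y. g (y - x) \<partial>lborel) = ?N" for x :: 'a
      using nn_integral_lborel_affine[of g 1 "-x"] nn_integral_gauss_kernel[OF a, where 'a='a]
      by (simp add: g_def add.commute)
    have tr2: "(\<integral>\<^sup>+x. g (y - x) \<partial>lborel) = ?N" for y :: 'a
      using nn_integral_lborel_affine[of g "-1" y] nn_integral_gauss_kernel[OF a, where 'a='a]
      by (simp add: g_def)
    have mag: "ennreal (cmod (h x) * (cmod (h y) * g (y - x))) \<le>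
        ennreal ((cmod (h x))\<^sup>2 / 2) * ennreal (g (y - x)) + ennreal ((cmod (h y))\<^sup>2 / 2) * ennreal (g (y - x))" for x y
    proof -
      have "cmod (h x) * cmod (h y) \<le> (cmod (h x))\<^sup>2 / 2 + (cmod (h y))\<^sup>2 / 2"
        using sum_squares_bound[of "cmod (h x)" "cmod (h y)"] by simp
      from mult_right_mono[OF this g0[of "y - x"]]
      show ?thesis using g0 by (simp add: ennreal_mult[symmetric] ennreal_plus[symmetric] algebra_simps del: ennreal_plus)
    qed
    have ih: "integrable lborel (\<lambda>x. h x * cnj (LINT y|lborel. h y * g (y - x)))"
    proof (rule Bochner_Integration.integrable_bound)
      show "integrable lborel (\<lambda>x. ((LINT y|lborel. cmod (h y)) * sqrt (pi / a) ^ DIM('a)) * cmod (h x))"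
        using h by simp
      have "cmod (LINT y|lborel. h y * g (y - x)) \<le> (LINT y|lborel. cmod (h y)) * sqrt (pi / a) ^ DIM('a)" for x
      proof -
        have "cmod (LINT y|lborel. h y * g (y - x)) \<le> (LINT y|lborel. cmod (h y) * sqrt (pi / a) ^ DIM('a))"
        proof (rule Bochner_Integration.integral_norm_bound_integral)
          show le: "cmod (h y * g (y - x)) \<le> cmod (h y) * sqrt (pi / a) ^ DIM('a)" for y
            using a g0[of "y - x"] by (simp add: norm_mult) (auto simp: g_def gauss_kernel_def mult_left_le intro!: mult_left_mono)
          show "integrable lborel (\<lambda>y. cmod (h y) * sqrt (pi / a) ^ DIM('a))"
            using h by simp
          then show "integrable lborel (\<lambda>y. h y * complex_of_real (g (y - x)))"
            by (rule Bochner_Integration.integrable_bound) (use a le in \<open>auto intro!: order.trans[OF _ abs_ge_self]\<close>)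
        qed
        then show ?thesis by simp
      qed
      from mult_right_mono[OF this norm_ge_zero]
      show "AE x in lborel. norm (h x * cnj (LINT y|lborel. h y * g (y - x))) \<le>
         norm (((LINT y|lborel. cmod (h y)) * sqrt (pi / a) ^ DIM('a)) * cmod (h x))"
        by (intro AE_I2) (auto simp: norm_mult mult.commute[of "cmod (h _)"] intro: order.trans[OF _ abs_ge_self])
    qed simp
    have "(\<integral>\<^sup>+\<xi>. (cmod (fourier h \<xi>))\<^sup>2 * exp (- a * (norm \<xi>)\<^sup>2) \<partial>lborel) =
       ennreal (LINT \<xi>|lborel. (cmod (fourier h \<xi>))\<^sup>2 * exp (- a * (norm \<xi>)\<^sup>2))"
      by (intro nn_integral_eq_integral integrable_fourier_gaussian h a) simp
    also have "\<dots> = ennreal (cmod (complex_of_real (LINT \<xi>|lborel. (cmod (fourier h \<xi>))\<^sup>2 * exp (- a * (norm \<xi>)\<^sup>2))))"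
      by (simp add: integral_nonneg)
    also have "\<dots> = ennreal (cmod (LINT x|lborel. h x * cnj (LINT y|lborel. h y * g (y - x))))"
      unfolding integral_fourier_gaussian[OF h a] g_def ..
    also have "\<dots> \<le> (\<integral>\<^sup>+x. norm (h x * cnj (LINT y|lborel. h y * g (y - x))) \<partial>lborel)"
      by (rule integral_norm_bound_ennreal[OF ih])
    also have "\<dots> \<le> (\<integral>\<^sup>+x. (\<integral>\<^sup>+y. ennreal (cmod (h x) * (cmod (h y) * g (y - x))) \<partial>lborel) \<partial>lborel)"
    proof (rule nn_integral_mono)
      fix x
      have "ennreal (cmod (LINT y|lborel. h y * g (y - x))) \<le> (\<integral>\<^sup>+y. ennreal (cmod (h y) * g (y - x)) \<partial>lborel)"
      proof (cases "integrable lborel (\<lambda>y. h y * g (y - x))")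
        case True
        from integral_norm_bound_ennreal[OF this] show ?thesis using g0 by (simp add: norm_mult)
      qed (simp add: not_integrable_integral_eq)
      from mult_left_mono[OF this, of "ennreal (cmod (h x))"]
      show "ennreal (norm (h x * cnj (LINT y|lborel. h y * g (y - x)))) \<le>
          (\<integral>\<^sup>+y. ennreal (cmod (h x) * (cmod (h y) * g (y - x))) \<partial>lborel)"
        using g0 by (simp add: norm_mult ennreal_mult nn_integral_cmult)
    qed
    also have "\<dots> \<le> (\<integral>\<^sup>+x. (\<integral>\<^sup>+y. ennreal ((cmod (h x))\<^sup>2 / 2) * ennreal (g (y - x)) +
        ennreal ((cmod (h y))\<^sup>2 / 2) * ennreal (g (y - x)) \<partial>lborel) \<partial>lborel)"
      by (intro nn_integral_mono mag)
    also have "\<dots> = (\<integral>\<^sup>+x. ennreal ((cmod (h x))\<^sup>2 / 2) * ?N \<partial>lborel) +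
        (\<integral>\<^sup>+x. (\<integral>\<^sup>+y. ennreal ((cmod (h y))\<^sup>2 / 2) * ennreal (g (y - x)) \<partial>lborel) \<partial>lborel)"
      by (simp add: nn_integral_add nn_integral_cmult tr1)
    also have "(\<integral>\<^sup>+x. (\<integral>\<^sup>+y. ennreal ((cmod (h y))\<^sup>2 / 2) * ennreal (g (y - x)) \<partial>lborel) \<partial>lborel) =
       (\<integral>\<^sup>+y. (\<integral>\<^sup>+x. ennreal ((cmod (h y))\<^sup>2 / 2) * ennreal (g (y - x)) \<partial>lborel) \<partial>lborel)"
      by (rule lborel_pair.Fubini') simp
    also have "\<dots> = (\<integral>\<^sup>+x. ennreal ((cmod (h x))\<^sup>2 / 2) * ?N \<partial>lborel)"
      by (simp add: nn_integral_cmult tr2)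
    also have "(\<integral>\<^sup>+x. ennreal ((cmod (h x))\<^sup>2 / 2) * ?N \<partial>lborel) + (\<integral>\<^sup>+x. ennreal ((cmod (h x))\<^sup>2 / 2) * ?N \<partial>lborel)
      = (\<integral>\<^sup>+x. ennreal ((cmod (h x))\<^sup>2) * ?N \<partial>lborel)"
      by (subst nn_integral_add[symmetric])
         (auto intro!: nn_integral_cong simp: ennreal_mult[symmetric] ennreal_plus[symmetric] simp del: ennreal_plus)
    also have "\<dots> = ?N * ?Q"
      by (simp add: nn_integral_multc mult.commute)
    finally show ?thesis .
  qed
  show ?thesis
  proof (rule fatou_tendsto_bound)
    show "(\<integral>\<^sup>+\<xi>. (cmod (fourier h \<xi>))\<^sup>2 * exp (- inverse (real (Suc m)) * (norm \<xi>)\<^sup>2) \<partial>lborel) \<le> ?N * ?Q" for m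
      by (rule bound) simp
    show "(\<lambda>m. ennreal ((cmod (fourier h \<xi>))\<^sup>2 * exp (- inverse (real (Suc m)) * (norm \<xi>)\<^sup>2)))
        \<longlonglongrightarrow> ennreal ((cmod (fourier h \<xi>))\<^sup>2)" for \<xi>
      using tendsto_mult_left[OF tendsto_exp_minus_inverse_Suc, of "(cmod (fourier h \<xi>))\<^sup>2"]
      by (intro tendsto_ennrealI) simp
  qed auto
qed

text \<open>
For bounded continuous \<open>h\<close> the convolution with the kernel tends pointwise and boundedly to
\<open>(2 \<pi>)^n h\<close>, so that the right-hand side of the weighted identity converges to the full square
norm.
\<close>

lemma plancherel_ge:
  fixes h :: "'a::euclidean_space \<Rightarrow> complex"
  assumes h: "integrable lborel h" and cont: "continuous_on UNIV h" and M: "\<And>x. cmod (h x) \<le> M"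
  shows "ennreal ((2 * pi) ^ DIM('a)) * (\<integral>\<^sup>+x. (cmod (h x))\<^sup>2 \<partial>lborel) \<le> (\<integral>\<^sup>+\<xi>. (cmod (fourier h \<xi>))\<^sup>2 \<partial>lborel)"
proof -
  note [measurable] = integrable_borelD[OF h]
  define N where "N = (2 * pi) ^ DIM('a)"
  define c where "c = (\<lambda>m. inverse (real (Suc m)))"
  have c: "c m > 0" for m by (simp add: c_def)
  have M0: "M \<ge> 0" using M[of 0] norm_ge_zero order.trans by blast
  \<comment> \<open>With this weight, y = x + c m *R z turns the kernel into one Gaussian G independent of m.\<close>
  define a where "a = (\<lambda>m. (c m)\<^sup>2 / 4)"
  have a: "a m > 0" for m using c[of m] by (simp add: a_def)
  define G where "G = (\<lambda>z::'a. (2 * sqrt pi) ^ DIM('a) * exp (- 1 * (norm z)\<^sup>2))"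
  have [measurable]: "G \<in> borel_measurable borel" by (simp add: G_def)
  have G0: "G z \<ge> 0" for z by (simp add: G_def)
  have iG: "integrable lborel G"
    unfolding G_def using integrable_gaussian[of 1, where 'a='a] by simp
  have intG: "(LINT z|lborel. G z) = N"
  proof -
    have "(LINT z|lborel. G z) = (2 * sqrt pi) ^ DIM('a) * (sqrt (pi / 1)) ^ DIM('a)"
      unfolding G_def using integral_gaussian[of 1, where 'a='a] by simp
    also have "\<dots> = (2 * sqrt pi * sqrt (pi / 1)) ^ DIM('a)" by (rule power_mult_distrib[symmetric])
    also have "2 * sqrt pi * sqrt (pi / 1) = 2 * pi" by simp
    finally show ?thesis unfolding N_def .
  qed
  define J where "J = (\<lambda>m x. LINT z|lborel. h (x + c m *\<^sub>R z) * G z)"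
  have J: "(LINT y|lborel. h y * gauss_kernel (a m) (y - x)) = J m x" for m x
  proof -
    have "(LINT y|lborel. h y * gauss_kernel (a m) (y - x)) =
       \<bar>c m\<bar> ^ DIM('a) *\<^sub>R (LINT z|lborel. h (x + c m *\<^sub>R z) * gauss_kernel (a m) ((x + c m *\<^sub>R z) - x))"
      using c[of m] by (subst integral_lborel_affine[where c = "c m" and t = x]) auto
    also have "\<dots> = (LINT z|lborel. h (x + c m *\<^sub>R z) * (\<bar>c m\<bar> ^ DIM('a) * gauss_kernel (a m) (c m *\<^sub>R z)))"
      by (subst integral_scaleR_right[symmetric]) (simp add: scaleR_conv_of_real mult_ac)
    also have "(\<lambda>z::'a. \<bar>c m\<bar> ^ DIM('a) * gauss_kernel (a m) (c m *\<^sub>R z)) = G"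
    proof
      fix z :: 'a
      have "c m * sqrt (pi / a m) = 2 * sqrt pi"
        using c[of m] by (simp add: a_def real_sqrt_divide real_sqrt_mult)
      moreover have "(norm (c m *\<^sub>R z))\<^sup>2 / (4 * a m) = (norm z)\<^sup>2"
        using c[of m] by (simp add: a_def power_mult_distrib)
      moreover have "\<bar>c m\<bar> ^ DIM('a) * gauss_kernel (a m) (c m *\<^sub>R z) =
          (c m * sqrt (pi / a m)) ^ DIM('a) * exp (- ((norm (c m *\<^sub>R z))\<^sup>2 / (4 * a m)))"
        using c[of m] by (simp add: gauss_kernel_def power_mult_distrib)
      ultimately show "\<bar>c m\<bar> ^ DIM('a) * gauss_kernel (a m) (c m *\<^sub>R z) = G z"
        by (simp add: G_def)
    qed
    finally show ?thesis unfolding J_def .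
  qed
  have Jm [measurable]: "J m \<in> borel_measurable borel" for m
    unfolding J_def by measurable
  have dom: "integrable lborel (\<lambda>z. M * G z)" using iG by simp
  have hG: "cmod (h (x + c m *\<^sub>R z) * G z) \<le> M * G z" for x z m
    using M G0 by (simp add: norm_mult mult_right_mono)
  have Jb: "cmod (J m x) \<le> M * N" for m x
  proof -
    have "cmod (J m x) \<le> (LINT z|lborel. M * G z)"
      unfolding J_def
      by (intro Bochner_Integration.integral_norm_bound_integral Bochner_Integration.integrable_bound[OF dom] dom)
         (use hG in \<open>auto intro!: AE_I2 order.trans[OF _ abs_ge_self]\<close>)
    then show ?thesis using intG by simp
  qed
  have Jlim: "(\<lambda>m. J m x) \<longlonglongrightarrow> h x * N" for x
  proof -
    have "(\<lambda>m. J m x) \<longlonglongrightarrow> (LINT z|lborel. h x * G z)"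
      unfolding J_def
    proof (rule integral_dominated_convergence[OF _ _ dom])
      show "AE z in lborel. (\<lambda>m. h (x + c m *\<^sub>R z) * complex_of_real (G z)) \<longlonglongrightarrow> h x * complex_of_real (G z)"
      proof (intro AE_I2 tendsto_mult_right)
        fix z
        have "(\<lambda>m. x + c m *\<^sub>R z) \<longlonglongrightarrow> x + 0 *\<^sub>R z"
          unfolding c_def by (intro tendsto_intros LIMSEQ_inverse_real_of_nat)
        then have "(\<lambda>m. x + c m *\<^sub>R z) \<longlonglongrightarrow> x" by simp
        moreover have "isCont h x" using cont by (simp add: continuous_on_eq_continuous_at)
        ultimately show "(\<lambda>m. h (x + c m *\<^sub>R z)) \<longlonglongrightarrow> h x" by (rule isCont_tendsto_compose[rotated])
      qed
    qed (use hG in auto)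
    also have "(LINT z|lborel. h x * G z) = h x * N"
      using intG iG by simp
    finally show ?thesis .
  qed
  have lim: "(\<lambda>m. LINT x|lborel. h x * cnj (J m x)) \<longlonglongrightarrow> (LINT x|lborel. h x * cnj (h x * N))"
  proof (rule integral_dominated_convergence)
    show "integrable lborel (\<lambda>x. M * N * cmod (h x))" using h by simp
    show "AE x in lborel. (\<lambda>m. h x * cnj (J m x)) \<longlonglongrightarrow> h x * cnj (h x * N)"
      by (intro AE_I2 tendsto_intros Jlim)
    show "AE x in lborel. norm (h x * cnj (J m x)) \<le> M * N * cmod (h x)" for m
      using Jb by (auto simp: norm_mult mult.commute[of "cmod (h _)"] intro!: AE_I2 mult_right_mono)
  qed auto
  have ih2: "integrable lborel (\<lambda>x. (cmod (h x))\<^sup>2)"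
  proof (rule Bochner_Integration.integrable_bound)
    show "integrable lborel (\<lambda>x. M * cmod (h x))" using h by simp
    show "AE x in lborel. norm ((cmod (h x))\<^sup>2) \<le> norm (M * cmod (h x))"
      using M M0 by (auto simp: power2_eq_square intro!: mult_right_mono)
  qed simp
  define S where "S = (\<lambda>m. LINT \<xi>|lborel. (cmod (fourier h \<xi>))\<^sup>2 * exp (- a m * (norm \<xi>)\<^sup>2))"
  have "(LINT x|lborel. h x * cnj (h x * N)) = complex_of_real (N * (LINT x|lborel. (cmod (h x))\<^sup>2))"
    unfolding integral_mult_right_zero[symmetric] integral_complex_of_real[symmetric]
    by (intro Bochner_Integration.integral_cong refl) (simp add: complex_norm_square mult_ac flip: of_real_power)
  with lim have "(\<lambda>m. complex_of_real (S m)) \<longlonglongrightarrow> complex_of_real (N * (LINT x|lborel. (cmod (h x))\<^sup>2))"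
    unfolding S_def integral_fourier_gaussian[OF h a] J by simp
  then have "S \<longlonglongrightarrow> N * (LINT x|lborel. (cmod (h x))\<^sup>2)"
    by (simp only: tendsto_of_real_iff)
  then have *: "(\<lambda>m. ennreal (S m)) \<longlonglongrightarrow> ennreal (N * (LINT x|lborel. (cmod (h x))\<^sup>2))"
    by (rule tendsto_ennrealI)
  have "ennreal (S m) \<le> (\<integral>\<^sup>+\<xi>. (cmod (fourier h \<xi>))\<^sup>2 \<partial>lborel)" for m
  proof -
    have "ennreal (S m) = (\<integral>\<^sup>+\<xi>. (cmod (fourier h \<xi>))\<^sup>2 * exp (- a m * (norm \<xi>)\<^sup>2) \<partial>lborel)"
      unfolding S_def by (intro nn_integral_eq_integral[symmetric] integrable_fourier_gaussian h a) simp
    also have "\<dots> \<le> (\<integral>\<^sup>+\<xi>. (cmod (fourier h \<xi>))\<^sup>2 \<partial>lborel)"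
      using a[of m] by (intro nn_integral_mono ennreal_leI) (simp add: mult_left_le)
    finally show ?thesis .
  qed
  with * have "ennreal (N * (LINT x|lborel. (cmod (h x))\<^sup>2)) \<le> (\<integral>\<^sup>+\<xi>. (cmod (fourier h \<xi>))\<^sup>2 \<partial>lborel)"
    by (intro tendsto_upperbound[OF *]) auto
  moreover have "(\<integral>\<^sup>+x. (cmod (h x))\<^sup>2 \<partial>lborel) = ennreal (LINT x|lborel. (cmod (h x))\<^sup>2)"
    by (intro nn_integral_eq_integral ih2) simp
  ultimately show ?thesis by (simp add: N_def ennreal_mult integral_nonneg)
qed

section \<open>The Riesz kernel as a superposition of Gaussians\<close>

lemma has_bochner_integral_Gamma:
  fixes p c :: real
  assumes p: "p > 0" and c: "c > 0"
  shows "has_bochner_integral lborel (\<lambda>t. indicator {0..} t * (t powr (p - 1) * exp (- (c * t)))) (Gamma p / c powr p)"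
proof -
  have "has_bochner_integral lborel (\<lambda>t. indicator {0..} t * t powr (p - 1) / exp t) (Gamma p)"
    using p by (intro has_bochner_integral_nn_integral Gamma_conv_nn_integral_real[symmetric]) (auto simp: less_imp_le Gamma_real_pos)
  then have "has_bochner_integral lborel (\<lambda>t. indicator {0..} (0 + c * t) * (0 + c * t) powr (p - 1) / exp (0 + c * t)) (Gamma p /\<^sub>R \<bar>c\<bar>)"
    using c by (subst (asm) lborel_has_bochner_integral_real_affine_iff[where c = c and t = 0]) auto
  then have "has_bochner_integral lborel (\<lambda>t. c powr (1 - p) * (indicator {0..} (0 + c * t) * (0 + c * t) powr (p - 1) / exp (0 + c * t)))
      (c powr (1 - p) * (Gamma p /\<^sub>R \<bar>c\<bar>))"
    by (intro has_bochner_integral_mult_right) auto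
  also have "c powr (1 - p) * (Gamma p /\<^sub>R \<bar>c\<bar>) = Gamma p / c powr p"
    using c by (simp add: powr_diff field_simps)
  also have "(\<lambda>t. c powr (1 - p) * (indicator {0..} (0 + c * t) * (0 + c * t) powr (p - 1) / exp (0 + c * t))) =
      (\<lambda>t. indicator {0..} t * (t powr (p - 1) * exp (- (c * t))))"
    using c by (auto simp: fun_eq_iff powr_mult exp_minus field_simps zero_le_mult_iff powr_diff split: split_indicator)
  finally show ?thesis .
qed

text \<open>
Euler's integral for \<open>Gamma p / c powr p\<close>, cut off to an interval that is invariant under
\<open>t \<mapsto> 1/t\<close>, which is what \<open>trunc_Gamma_half\<close> exploits.
\<close>

definition trunc_Gamma :: "real \<Rightarrow> nat \<Rightarrow> real \<Rightarrow> real"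
  where "trunc_Gamma p m c =
    (LINT t|lborel. indicator {1 / real (Suc m)..real (Suc m)} t * (t powr (p - 1) * exp (- (c * t))))"

lemma measurable_trunc_Gamma [measurable]: "trunc_Gamma p m \<in> borel_measurable borel"
  unfolding trunc_Gamma_def[abs_def] by measurable

lemma trunc_Gamma_nonneg: "trunc_Gamma p m c \<ge> 0"
  unfolding trunc_Gamma_def by (intro integral_nonneg_AE AE_I2) (auto split: split_indicator)

lemma integrable_powr_trunc:
  "integrable lborel (\<lambda>t. indicator {1 / real (Suc m)..real (Suc m)} t * t powr (q::real))"
proof -
  have "set_integrable lborel {1 / real (Suc m)..real (Suc m)} (\<lambda>t. t powr q)"
    by (intro borel_integrable_atLeastAtMost' continuous_intros) auto
  then show ?thesis by (simp add: set_integrable_def)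
qed

lemma
  assumes p: "p > 0" and c: "c > 0"
  shows trunc_Gamma_le: "trunc_Gamma p m c \<le> Gamma p / c powr p"
    and trunc_Gamma_tendsto: "(\<lambda>m. trunc_Gamma p m c) \<longlonglongrightarrow> Gamma p / c powr p"
proof -
  let ?f = "\<lambda>t. t powr (p - 1) * exp (- (c * t))"
  note G = has_bochner_integral_Gamma[OF p c]
  have int: "integrable lborel (\<lambda>t. indicator {0..} t * ?f t)"
    and G': "Gamma p / c powr p = (LINT t|lborel. indicator {0..} t * ?f t)"
    using G by (auto simp: has_bochner_integral_iff)
  have sub: "t \<ge> 0" if "t \<ge> 1 / real (Suc m)" for t m
    using that by (rule order.trans[rotated]) simp
  have le: "indicator {1 / real (Suc m)..real (Suc m)} t * ?f t \<le> indicator {0..} t * ?f t" for m t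
    using sub[of m t] by (auto split: split_indicator)
  have intm: "integrable lborel (\<lambda>t. indicator {1 / real (Suc m)..real (Suc m)} t * ?f t)" for m
    by (rule Bochner_Integration.integrable_bound[OF int]) (use le[of m] in \<open>auto simp: abs_mult intro!: AE_I2\<close>)
  show "trunc_Gamma p m c \<le> Gamma p / c powr p"
    unfolding G' trunc_Gamma_def by (intro integral_mono intm int le)
  show "(\<lambda>m. trunc_Gamma p m c) \<longlonglongrightarrow> Gamma p / c powr p"
    unfolding G' trunc_Gamma_def
  proof (rule integral_dominated_convergence[OF _ _ int])
    show "AE t in lborel. (\<lambda>m. indicator {1 / real (Suc m)..real (Suc m)} t * ?f t) \<longlonglongrightarrow> indicator {0..} t * ?f t"
    proof (intro AE_I2)
      fix t :: real
      show "(\<lambda>m. indicator {1 / real (Suc m)..real (Suc m)} t * ?f t) \<longlonglongrightarrow> indicator {0..} t * ?f t"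
      proof (cases "t > 0")
        case True
        have "\<forall>\<^sub>F m in sequentially. 1 / real (Suc m) < t"
          using order_tendstoD(2)[OF LIMSEQ_inverse_real_of_nat True] by (simp add: inverse_eq_divide)
        moreover have "\<forall>\<^sub>F m in sequentially. t \<le> real (Suc m)"
          using eventually_ge_at_top[of "nat \<lceil>t\<rceil>"] by eventually_elim linarith
        ultimately have "\<forall>\<^sub>F m in sequentially. indicator {1 / real (Suc m)..real (Suc m)} t * ?f t = indicator {0..} t * ?f t"
          by eventually_elim (use True in auto)
        then show ?thesis by (rule tendsto_eventually)
      next
        case False
        have "t \<notin> {1 / real (Suc m)..real (Suc m)}" if "t \<noteq> 0" for m
          using sub[of m t] False that by auto
        then have "indicator {1 / real (Suc m)..real (Suc m)} t * ?f t = indicator {0..} t * ?f t" for m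
          using False by (cases "t = 0") (auto split: split_indicator)
        from this[abs_def] show ?thesis by (simp only: tendsto_const)
      qed
    qed
    show "AE t in lborel. norm (indicator {1 / real (Suc m)..real (Suc m)} t * ?f t) \<le> indicator {0..} t * ?f t" for m
      using le[of m] by (intro AE_I2) (simp add: abs_mult)
  qed auto
qed

lemma trunc_Gamma_half:
  "(LINT t|lborel. indicator {1 / real (Suc m)..real (Suc m)} t * (t powr (- 3 / 2) * exp (- (c / t)))) = trunc_Gamma (1 / 2) m c"
proof -
  define r where "r = real (Suc m)"
  have r: "r \<ge> 1" "1 / r \<le> r" by (auto simp: r_def field_simps)
  let ?f = "\<lambda>y. y powr (- 1 / 2) * exp (- (c * y))"
  have pos: "x > 0" if "1 / r \<le> x" for x using that r by (smt (verit) divide_pos_pos)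
  have "(LBINT x=1 / r..r. (- (1 / x\<^sup>2)) *\<^sub>R ?f (1 / x)) = (LBINT y=1 / (1 / r)..1 / r. ?f y)"
  proof (rule interval_integral_substitution_finite[OF r(2)])
    show "((\<lambda>x. 1 / x) has_real_derivative - (1 / x\<^sup>2)) (at x within {1 / r..r})" if "1 / r \<le> x" for x
      using pos[OF that] by (auto intro!: derivative_eq_intros simp: power2_eq_square)
    have "y > 0" if "y \<in> (\<lambda>x. 1 / x) ` {1 / r..r}" for y
      using that pos by fastforce
    then show "continuous_on ((\<lambda>x. 1 / x) ` {1 / r..r}) ?f"
      by (intro continuous_intros) (metis less_irrefl)+
    have "x \<noteq> 0" if "x \<in> {1 / r..r}" for x
      using pos[of x] that by auto
    then show "continuous_on {1 / r..r} (\<lambda>x. - (1 / x\<^sup>2))"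
      by (intro continuous_intros) auto
  qed
  also have "(LBINT y=1 / (1 / r)..1 / r. ?f y) = - (LBINT y=1 / r..r. ?f y)"
    by (subst interval_integral_endpoints_reverse) simp
  also have "(LBINT y=1 / r..r. ?f y) = trunc_Gamma (1 / 2) m c"
    unfolding interval_integral_Icc[OF r(2)] unfolding trunc_Gamma_def set_lebesgue_integral_def r_def by simp
  also have "(LBINT x=1 / r..r. (- (1 / x\<^sup>2)) *\<^sub>R ?f (1 / x)) =
     (LINT x|lborel. - (indicator {1 / r..r} x * (x powr (- 3 / 2) * exp (- (c / x)))))"
    unfolding interval_integral_Icc[OF r(2)] set_lebesgue_integral_def
  proof (intro Bochner_Integration.integral_cong refl)
    fix x :: real
    have "(1 / x\<^sup>2) * (1 / x) powr (- 1 / 2) = x powr (- 3 / 2)" if "x > 0"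
    proof -
      have "1 / x\<^sup>2 = x powr (- 2)" "(1 / x) powr (- 1 / 2) = x powr (1 / 2)"
        using that by (simp_all add: powr_divide powr_minus_divide)
      then have "(1 / x\<^sup>2) * (1 / x) powr (- 1 / 2) = x powr (- 2) * x powr (1 / 2)" by simp
      then show ?thesis by (simp flip: powr_add)
    qed
    then have "indicat_real {1 / r..r} x * ((1 / x\<^sup>2) * (1 / x) powr (- 1 / 2)) * exp (- (c * (1 / x))) =
        indicat_real {1 / r..r} x * x powr (- 3 / 2) * exp (- (c * (1 / x)))"
      using pos[of x] by (cases "x \<in> {1 / r..r}") (simp_all del: times_divide_eq_left)
    then show "indicat_real {1 / r..r} x *\<^sub>R (- (1 / x\<^sup>2)) *\<^sub>R ?f (1 / x) =
       - (indicator {1 / r..r} x * (x powr (- 3 / 2) * exp (- (c / x))))"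
      by (simp add: mult_ac)
  qed
  finally show ?thesis by (simp add: r_def)
qed

text \<open>
By Euler's integral these are truncations of the Riesz kernel. They are integrable superpositions of
the functions \<open>(y \<bullet> e) exp (-t |y|\<^sup>2)\<close>, whose Fourier transforms are explicit.
\<close>

definition riesz_trunc :: "nat \<Rightarrow> 'a::euclidean_space \<Rightarrow> 'a \<Rightarrow> real"
  where "riesz_trunc m e y =
    (y \<bullet> e) * trunc_Gamma ((real DIM('a) + 1) / 2) m ((norm y)\<^sup>2) / pi powr ((real DIM('a) + 1) / 2)"

lemma measurable_riesz_trunc [measurable]: "riesz_trunc m e \<in> borel_measurable borel"
  unfolding riesz_trunc_def[abs_def] by measurable

text \<open>
Transforming each Gaussian produces the weight \<open>t powr (-3/2) exp (-|\<xi>|\<^sup>2 / (4 t))\<close>, which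
\<open>t \<mapsto> 1/t\<close> turns into Euler's integrand for \<open>Gamma (1/2)\<close>, whatever the dimension.
\<close>

lemma
  fixes e \<xi> :: "'a::euclidean_space"
  assumes e: "e \<in> Basis"
  shows integrable_riesz_trunc: "integrable lborel (\<lambda>y. complex_of_real (riesz_trunc m e y))"
    and fourier_riesz_trunc: "fourier (\<lambda>y. complex_of_real (riesz_trunc m e y)) \<xi> =
      - \<i> * complex_of_real ((\<xi> \<bullet> e) / (2 * sqrt pi) * trunc_Gamma (1 / 2) m ((norm \<xi>)\<^sup>2 / 4))"
proof -
  define p where "p = (real DIM('a) + 1) / 2"
  define r where "r = real (Suc m)"
  have r: "r \<ge> 1" by (simp add: r_def)
  have pos: "t > 0" if "1 / r \<le> t" for t using that r by (smt (verit) divide_pos_pos)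
  define c where "c = (\<lambda>t. indicator {1 / r..r} t * t powr (p - 1) / pi powr p)"
  have c0: "c t \<ge> 0" for t by (simp add: c_def)
  have cI: "c t = 0 \<or> 1 / r \<le> t" for t by (auto simp: c_def)
  define F where "F = (\<lambda>t y. complex_of_real (c t * ((y \<bullet> e) * exp (- t * (norm y)\<^sup>2))))"
  have [measurable]: "c \<in> borel_measurable borel" unfolding c_def by measurable
  have [measurable]: "case_prod F \<in> borel_measurable (borel \<Otimes>\<^sub>M borel)" unfolding F_def by measurable
  have F: "integrable (lborel \<Otimes>\<^sub>M lborel) (case_prod F)"
  proof (rule Bochner_Integration.integrable_bound)
    have "integrable lborel (\<lambda>t. complex_of_real (c t))"
      unfolding c_def r_def complex_of_real_integrable_eq by (intro integrable_divide integrable_powr_trunc)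
    moreover have "integrable lborel (\<lambda>y. complex_of_real ((y \<bullet> e) * exp (- (1 / r) * (norm y)\<^sup>2)))"
      using r by (intro fourier_moment_gaussian e) auto
    ultimately show "integrable (lborel \<Otimes>\<^sub>M lborel)
        (\<lambda>(t, y). complex_of_real (c t) * complex_of_real ((y \<bullet> e) * exp (- (1 / r) * (norm y)\<^sup>2)))"
      by (rule integrable_tensor)
    \<comment> \<open>On the support of c the flattest Gaussian, at t = 1/r, dominates.\<close>
    have "norm (F t y) \<le> norm (complex_of_real (c t) * complex_of_real ((y \<bullet> e) * exp (- (1 / r) * (norm y)\<^sup>2)))" for t y
    proof (cases "c t = 0")
      case False
      then have "(1 / r) * (norm y)\<^sup>2 \<le> t * (norm y)\<^sup>2" using cI[of t] by (intro mult_right_mono) auto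
      then show ?thesis using c0[of t] by (auto simp: F_def norm_mult abs_mult intro!: mult_left_mono)
    qed (simp add: F_def)
    then show "AE x in lborel \<Otimes>\<^sub>M lborel. norm (case_prod F x) \<le>
        norm (case x of (t, y) \<Rightarrow> complex_of_real (c t) * complex_of_real ((y \<bullet> e) * exp (- (1 / r) * (norm y)\<^sup>2)))"
      by auto
  qed simp
  have K: "(LINT t|lborel. F t y) = complex_of_real (riesz_trunc m e y)" for y
  proof -
    have "(LINT t|lborel. F t y) = complex_of_real (LINT t|lborel. ((y \<bullet> e) / pi powr p) *
        (indicator {1 / r..r} t * (t powr (p - 1) * exp (- ((norm y)\<^sup>2 * t)))))"
      unfolding F_def integral_complex_of_real c_def
      by (intro arg_cong[of _ _ complex_of_real] Bochner_Integration.integral_cong refl) (simp add: mult_ac)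
    then show ?thesis
      by (simp add: riesz_trunc_def trunc_Gamma_def p_def r_def)
  qed
  show "integrable lborel (\<lambda>y. complex_of_real (riesz_trunc m e y))"
    using lborel_pair.integrable_snd[OF F] unfolding K .
  have Fc: "integrable (lborel \<Otimes>\<^sub>M lborel) (\<lambda>(t, y). F t y * cis (- (y \<bullet> \<xi>)))"
    by (rule Bochner_Integration.integrable_bound[OF F]) (auto simp: norm_mult)
  have "fourier (\<lambda>y. complex_of_real (riesz_trunc m e y)) \<xi> =
      (LINT y|lborel. (LINT t|lborel. F t y * cis (- (y \<bullet> \<xi>))))"
    unfolding fourier_def K[symmetric] by (simp flip: integral_mult_left_zero)
  also have "\<dots> = (LINT t|lborel. (LINT y|lborel. F t y * cis (- (y \<bullet> \<xi>))))"
    by (rule lborel_pair.Fubini_integral[OF Fc])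
  also have "(\<lambda>t. LINT y|lborel. F t y * cis (- (y \<bullet> \<xi>))) = 
     (\<lambda>t. (- \<i> * complex_of_real ((\<xi> \<bullet> e) / (2 * sqrt pi))) *
       complex_of_real (indicator {1 / r..r} t * (t powr (- 3 / 2) * exp (- (((norm \<xi>)\<^sup>2 / 4) / t)))))"
  proof
    fix t
    show "(LINT y|lborel. F t y * cis (- (y \<bullet> \<xi>))) = (- \<i> * complex_of_real ((\<xi> \<bullet> e) / (2 * sqrt pi))) *
       complex_of_real (indicator {1 / r..r} t * (t powr (- 3 / 2) * exp (- (((norm \<xi>)\<^sup>2 / 4) / t))))"
    proof (cases "t \<in> {1 / r..r}")
      case True
      then have t: "t > 0" using pos by auto
      have sq: "sqrt (pi / t) ^ DIM('a) = pi powr (real DIM('a) / 2) * t powr (- real DIM('a) / 2)"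
        using t by (simp add: powr_half_sqrt[symmetric] powr_powr powr_realpow[symmetric] powr_divide powr_minus_divide)
      have pw: "c t * (1 / (2 * t) * sqrt (pi / t) ^ DIM('a)) = 1 / (2 * sqrt pi) * t powr (- 3 / 2)"
      proof -
        have "t powr (p - 1) * t powr (-1) * t powr (- real DIM('a) / 2) = t powr (- 3 / 2)"
          unfolding powr_add[symmetric] by (simp add: p_def field_simps)
        moreover have "pi powr (real DIM('a) / 2) / pi powr p = 1 / sqrt pi"
          by (simp add: p_def powr_half_sqrt[symmetric] powr_add add_divide_distrib)
        ultimately show ?thesis
          unfolding sq using t True by (simp add: c_def powr_minus_divide field_simps)
      qed
      have "(LINT y|lborel. F t y * cis (- (y \<bullet> \<xi>))) =
         complex_of_real (c t) * fourier (\<lambda>y. complex_of_real ((y \<bullet> e) * exp (- t * (norm y)\<^sup>2))) \<xi>"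
        unfolding F_def fourier_def by (simp add: mult.assoc flip: integral_mult_right_zero)
      also have "\<dots> = - \<i> * complex_of_real ((c t * (1 / (2 * t) * sqrt (pi / t) ^ DIM('a))) * ((\<xi> \<bullet> e) * exp (- (norm \<xi>)\<^sup>2 / (4 * t))))"
        unfolding fourier_moment_gaussian(2)[OF t e] by simp
      finally show ?thesis
        unfolding pw using True by (simp add: field_simps)
    qed (simp add: F_def c_def)
  qed
  also have "(LINT t|lborel. (- \<i> * complex_of_real ((\<xi> \<bullet> e) / (2 * sqrt pi))) *
       complex_of_real (indicator {1 / r..r} t * (t powr (- 3 / 2) * exp (- (((norm \<xi>)\<^sup>2 / 4) / t))))) =
      (- \<i> * complex_of_real ((\<xi> \<bullet> e) / (2 * sqrt pi))) * complex_of_real (trunc_Gamma (1 / 2) m ((norm \<xi>)\<^sup>2 / 4))"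
    unfolding integral_mult_right_zero integral_complex_of_real r_def trunc_Gamma_half ..
  finally show "fourier (\<lambda>y. complex_of_real (riesz_trunc m e y)) \<xi> =
      - \<i> * complex_of_real ((\<xi> \<bullet> e) / (2 * sqrt pi) * trunc_Gamma (1 / 2) m ((norm \<xi>)\<^sup>2 / 4))"
    by simp
qed

text \<open>
At \<open>\<xi> = 0\<close> the value is \<open>0\<close>, which is also the value of the transforms of the truncated kernels
there; their convergence therefore holds everywhere.
\<close>

definition riesz_mult :: "'a::euclidean_space \<Rightarrow> 'a \<Rightarrow> complex"
  where "riesz_mult e \<xi> = - \<i> * complex_of_real ((\<xi> \<bullet> e) / norm \<xi>)"

lemma
  fixes e \<xi> :: "'a::euclidean_space"
  assumes e: "e \<in> Basis"
  shows norm_fourier_riesz_trunc_le: "norm (fourier (\<lambda>y. complex_of_real (riesz_trunc m e y)) \<xi>) \<le> 1"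
    and fourier_riesz_trunc_tendsto:
      "(\<lambda>m. fourier (\<lambda>y. complex_of_real (riesz_trunc m e y)) \<xi>) \<longlonglongrightarrow> riesz_mult e \<xi>"
proof -
  have G: "Gamma (1 / 2) / ((norm \<xi>)\<^sup>2 / 4) powr (1 / 2) = 2 * sqrt pi / norm \<xi>"
    by (simp add: Gamma_one_half_real powr_half_sqrt real_sqrt_divide)
  show "norm (fourier (\<lambda>y. complex_of_real (riesz_trunc m e y)) \<xi>) \<le> 1"
  proof (cases "\<xi> = 0")
    case False
    have "trunc_Gamma (1 / 2) m ((norm \<xi>)\<^sup>2 / 4) \<le> 2 * sqrt pi / norm \<xi>"
      unfolding G[symmetric] using False by (intro trunc_Gamma_le) auto
    then have "\<bar>\<xi> \<bullet> e\<bar> / (2 * sqrt pi) * trunc_Gamma (1 / 2) m ((norm \<xi>)\<^sup>2 / 4) \<le>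
        norm \<xi> / (2 * sqrt pi) * (2 * sqrt pi / norm \<xi>)"
      using Basis_le_norm[OF e, of \<xi>] by (intro mult_mono divide_right_mono) (auto simp: trunc_Gamma_nonneg)
    then show ?thesis
      unfolding fourier_riesz_trunc[OF e] using False
      by (simp add: norm_mult norm_divide trunc_Gamma_nonneg)
  qed (simp add: fourier_riesz_trunc[OF e])
  show "(\<lambda>m. fourier (\<lambda>y. complex_of_real (riesz_trunc m e y)) \<xi>) \<longlonglongrightarrow> riesz_mult e \<xi>"
  proof (cases "\<xi> = 0")
    case False
    have "(\<lambda>m. - \<i> * complex_of_real ((\<xi> \<bullet> e) / (2 * sqrt pi) * trunc_Gamma (1 / 2) m ((norm \<xi>)\<^sup>2 / 4)))
      \<longlonglongrightarrow> - \<i> * complex_of_real ((\<xi> \<bullet> e) / (2 * sqrt pi) * (2 * sqrt pi / norm \<xi>))"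
      unfolding G[symmetric] using False by (intro tendsto_intros trunc_Gamma_tendsto) auto
    then show ?thesis
      unfolding fourier_riesz_trunc[OF e] riesz_mult_def by (simp del: of_real_mult of_real_divide)
  qed (simp add: fourier_riesz_trunc[OF e] riesz_mult_def)
qed

definition riesz_kernel :: "'a::euclidean_space \<Rightarrow> 'a \<Rightarrow> real"
  where "riesz_kernel e y = riesz_const DIM('a) * ((y \<bullet> e) / norm y ^ (DIM('a) + 1))"

lemma riesz_const_nonneg: "riesz_const n \<ge> 0"
  by (simp add: riesz_const_def Gamma_real_nonneg)

lemma measurable_riesz_kernel [measurable]: "riesz_kernel e \<in> borel_measurable borel"
  unfolding riesz_kernel_def[abs_def] by measurable

lemma
  fixes e y :: "'a::euclidean_space"
  shows riesz_trunc_le: "\<bar>riesz_trunc m e y\<bar> \<le> \<bar>riesz_kernel e y\<bar>"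
    and riesz_trunc_tendsto: "(\<lambda>m. riesz_trunc m e y) \<longlonglongrightarrow> riesz_kernel e y"
proof -
  define p where "p = (real DIM('a) + 1) / 2"
  have p: "p > 0" by (simp add: p_def)
  have K: "riesz_kernel e y = (y \<bullet> e) * (Gamma p / ((norm y)\<^sup>2) powr p) / pi powr p" if "y \<noteq> 0"
  proof -
    have "((norm y)\<^sup>2) powr p = norm y powr (2 * p)"
      using that by (simp add: powr_powr flip: powr_numeral)
    also have "2 * p = real (DIM('a) + 1)" by (simp add: p_def)
    also have "norm y powr real (DIM('a) + 1) = norm y ^ (DIM('a) + 1)"
      using that by (intro powr_realpow) simp
    finally have "((norm y)\<^sup>2) powr p = norm y ^ (DIM('a) + 1)" .
    then show ?thesis by (simp add: riesz_kernel_def riesz_const_def p_def field_simps)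
  qed
  show "\<bar>riesz_trunc m e y\<bar> \<le> \<bar>riesz_kernel e y\<bar>"
  proof (cases "y = 0")
    case False
    have "\<bar>y \<bullet> e\<bar> * trunc_Gamma p m ((norm y)\<^sup>2) / pi powr p \<le> \<bar>y \<bullet> e\<bar> * (Gamma p / ((norm y)\<^sup>2) powr p) / pi powr p"
      using False p by (intro divide_right_mono mult_left_mono trunc_Gamma_le) auto
    then show ?thesis
      unfolding K[OF False] riesz_trunc_def p_def[symmetric]
      using p by (simp add: abs_mult trunc_Gamma_nonneg Gamma_real_pos less_imp_le)
  qed (simp add: riesz_trunc_def)
  show "(\<lambda>m. riesz_trunc m e y) \<longlonglongrightarrow> riesz_kernel e y"
  proof (cases "y = 0")
    case False
    then show ?thesis
      unfolding K[OF False] riesz_trunc_def p_def[symmetric]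
      using p by (intro tendsto_intros trunc_Gamma_tendsto) auto
  qed (simp add: riesz_trunc_def riesz_kernel_def)
qed

lemma riesz_kernel_minus: "riesz_kernel e (- y) = - riesz_kernel e y"
  by (simp add: riesz_kernel_def)

lemma riesz_trunc_minus: "riesz_trunc m e (- y) = - riesz_trunc m e y"
  by (simp add: riesz_trunc_def)

text \<open>
The integrand is at most a constant times \<open>|y|^(1-n)\<close>. Since \<open>|y|\<close> is at least every \<open>|y \<bullet> b|\<close>,
this power is at most the product over the coordinates of \<open>|y \<bullet> b| powr (1/n - 1)\<close>, which is
integrable over a cube by one-dimensional integration.
\<close>

lemma integrable_norm_riesz_kernel_ball:
  fixes e :: "'a::euclidean_space"
  assumes e: "e \<in> Basis"
  shows "integrable lborel (\<lambda>y. indicator (cball 0 1) y * (norm y * riesz_kernel e y))"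
proof -
  define q where "q = 1 / real DIM('a)"
  have q: "q > 0" by (simp add: q_def)
  define w where "w = (\<lambda>t. indicator {-1..1} t * \<bar>t\<bar> powr (q - 1) :: real)"
  have half: "integrable lborel (\<lambda>t::real. indicator {0..1} t * t powr (q - 1))"
  proof (rule Bochner_Integration.integrable_bound)
    show "integrable lborel (\<lambda>t. exp 1 * (indicator {0..} t * (t powr (q - 1) * exp (- (1 * t)))))"
      using has_bochner_integral_Gamma[OF q, of 1] by (intro integrable_mult_right) (auto simp: has_bochner_integral_iff)
    show "AE t in lborel. norm (indicator {0..1} t * t powr (q - 1)) \<le> norm (exp 1 * (indicator {0..} t * (t powr (q - 1) * exp (- (1 * t)))))"
    proof (intro AE_I2)
      fix t :: real
      have "t powr (q - 1) * 1 \<le> t powr (q - 1) * (exp 1 * exp (- t))" if "t \<le> 1"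
        using that by (intro mult_left_mono) (auto simp flip: exp_add)
      then show "norm (indicator {0..1} t * t powr (q - 1)) \<le> norm (exp 1 * (indicator {0..} t * (t powr (q - 1) * exp (- (1 * t)))))"
        by (auto simp: abs_mult mult_ac split: split_indicator)
    qed
  qed simp
  have iw: "integrable lborel w"
  proof (rule Bochner_Integration.integrable_bound)
    have half': "integrable lborel (\<lambda>t::real. indicator {0..1} (0 + -1 * t) * (0 + -1 * t) powr (q - 1))"
      by (rule lborel_integrable_real_affine[OF half]) simp
    show "integrable lborel (\<lambda>t::real. indicator {0..1} t * t powr (q - 1) + indicator {0..1} (0 + -1 * t) * (0 + -1 * t) powr (q - 1))"
      by (intro Bochner_Integration.integrable_add half half')
    show "AE t in lborel. norm (w t) \<le> norm (indicator {0..1} t * t powr (q - 1) + indicator {0..1} (0 + -1 * t) * (0 + -1 * t) powr (q - 1))"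
      by (intro AE_I2) (auto simp: w_def split: split_indicator)
  qed (simp add: w_def)
  have "integrable lborel (\<lambda>y::'a. \<Prod>b\<in>Basis. complex_of_real (w (y \<bullet> b)))"
    using iw by (intro integrable_lborel_prod) simp
  then have iP: "integrable lborel (\<lambda>y::'a. \<Prod>b\<in>Basis. w (y \<bullet> b))"
    unfolding of_real_prod[symmetric] complex_of_real_integrable_eq .
  \<comment> \<open>On the coordinate hyperplanes the product vanishes, as 0 powr x = 0, so they must be excluded.\<close>
  have bound: "\<bar>norm y * riesz_kernel e y\<bar> \<le> riesz_const DIM('a) * (\<Prod>b\<in>Basis. w (y \<bullet> b))"
    if y: "norm y \<le> 1" and nz: "\<forall>b\<in>Basis. y \<bullet> b \<noteq> 0" for y
  proof -
    have y0: "norm y > 0" using nz e by auto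
    have "norm y * (\<bar>y \<bullet> e\<bar> / norm y ^ (DIM('a) + 1)) \<le> norm y * (norm y / norm y ^ (DIM('a) + 1))"
      using Basis_le_norm[OF e] by (intro mult_left_mono divide_right_mono) auto
    also have "\<dots> = norm y powr (1 - real DIM('a))"
      using y0 by (simp add: powr_diff powr_realpow)
    also have "\<dots> = (norm y powr (q - 1)) ^ DIM('a)"
      using y0 by (simp add: powr_realpow[symmetric] powr_powr q_def left_diff_distrib)
    also have "\<dots> = (\<Prod>b\<in>(Basis::'a set). norm y powr (q - 1))" by simp
    also have "\<dots> \<le> (\<Prod>b\<in>Basis. w (y \<bullet> b))"
    proof (rule prod_mono, safe)
      fix b :: 'a assume b: "b \<in> Basis"
      have le: "\<bar>y \<bullet> b\<bar> \<le> norm y" by (rule Basis_le_norm[OF b])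
      have "q \<le> 1" by (simp add: q_def)
      then have "norm y powr (q - 1) \<le> \<bar>y \<bullet> b\<bar> powr (q - 1)"
        using le nz b by (intro powr_mono2') auto
      then show "norm y powr (q - 1) \<le> w (y \<bullet> b)"
        using le y by (auto simp: w_def split: split_indicator)
    qed simp
    finally have "riesz_const DIM('a) * (norm y * (\<bar>y \<bullet> e\<bar> / norm y ^ (DIM('a) + 1))) \<le> riesz_const DIM('a) * (\<Prod>b\<in>Basis. w (y \<bullet> b))"
      by (intro mult_left_mono riesz_const_nonneg)
    then show ?thesis using riesz_const_nonneg[of "DIM('a)"] y0
      by (simp add: riesz_kernel_def abs_mult mult_ac)
  qed
  have "AE y in lborel. \<forall>b\<in>Basis. (y::'a) \<bullet> b \<noteq> 0"
    by (intro AE_finite_allI AE_lborel_inner_neq) auto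
  then have ae: "AE y in lborel. norm (indicator (cball 0 1) y * (norm y * riesz_kernel e y)) \<le>
      norm (riesz_const DIM('a) * (\<Prod>b\<in>Basis. w (y \<bullet> b)))"
  proof eventually_elim
    case (elim y)
    then show ?case
      using bound[of y] by (auto simp: mem_cball_0 split: split_indicator)
  qed
  have [measurable]: "cball (0::'a) 1 \<in> sets borel" by simp
  show ?thesis
    by (rule Bochner_Integration.integrable_bound[OF integrable_mult_right[OF iP] _ ae]) measurable
qed

section \<open>Convolution and the principal value\<close>

definition convol :: "('a::euclidean_space \<Rightarrow> complex) \<Rightarrow> ('a \<Rightarrow> complex) \<Rightarrow> 'a \<Rightarrow> complex"
  where "convol k g x = (LINT y|lborel. k y * g (x - y))"

lemma measurable_convol [measurable]:
  assumes [measurable]: "k \<in> borel_measurable borel" "g \<in> borel_measurable borel"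
  shows "convol k g \<in> borel_measurable borel"
  unfolding convol_def[abs_def] by measurable

lemma
  fixes k g :: "'a::euclidean_space \<Rightarrow> complex"
  assumes k: "integrable lborel k" and g: "integrable lborel g"
  shows integrable_convol: "integrable lborel (convol k g)"
    and fourier_convol: "fourier (convol k g) \<xi> = fourier k \<xi> * fourier g \<xi>"
proof -
  note [measurable] = integrable_borelD[OF k] integrable_borelD[OF g]
  have tr: "(\<integral>\<^sup>+x. ennreal (norm (g (x - y))) \<partial>lborel) = (\<integral>\<^sup>+x. ennreal (norm (g x)) \<partial>lborel)" for y
    using nn_integral_lborel_affine[of "\<lambda>x. ennreal (norm (g x))" 1 "-y"] by simp
  have fin: "(\<integral>\<^sup>+y. ennreal (norm (k y)) \<partial>lborel) < \<infinity>" "(\<integral>\<^sup>+x. ennreal (norm (g x)) \<partial>lborel) < \<infinity>"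
    using k g by (auto simp: integrable_iff_bounded)
  have int: "integrable (lborel \<Otimes>\<^sub>M lborel) (\<lambda>(y, x). k y * g (x - y))"
    using fin by (intro integrable_pairI)
      (auto simp: norm_mult ennreal_mult nn_integral_cmult nn_integral_multc tr ennreal_mult_less_top)
  show "integrable lborel (convol k g)"
    using lborel_pair.integrable_snd[OF int] by (simp add: convol_def[abs_def])
  have intc: "integrable (lborel \<Otimes>\<^sub>M lborel) (\<lambda>(y, x). k y * g (x - y) * cis (- (x \<bullet> \<xi>)))"
    by (rule Bochner_Integration.integrable_bound[OF int]) (auto simp: norm_mult)
  have "fourier (convol k g) \<xi> = (LINT x|lborel. (LINT y|lborel. k y * g (x - y) * cis (- (x \<bullet> \<xi>))))"
    unfolding fourier_def convol_def by (simp flip: integral_mult_left_zero)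
  also have "\<dots> = (LINT y|lborel. (LINT x|lborel. k y * g (x - y) * cis (- (x \<bullet> \<xi>))))"
    by (rule lborel_pair.Fubini_integral[OF intc])
  also have "(\<lambda>y. LINT x|lborel. k y * g (x - y) * cis (- (x \<bullet> \<xi>))) = (\<lambda>y. k y * cis (- (y \<bullet> \<xi>)) * fourier g \<xi>)"
  proof
    fix y
    have "(LINT x|lborel. k y * g (x - y) * cis (- (x \<bullet> \<xi>))) =
        (LINT x|lborel. (k y * cis (- (y \<bullet> \<xi>))) * (g x * cis (- (x \<bullet> \<xi>))))"
      by (subst integral_lborel_affine[where c = 1 and t = y])
         (auto simp: inner_add_left cis_mult add.commute mult.assoc mult.left_commute intro!: Bochner_Integration.integral_cong)
    then show "(LINT x|lborel. k y * g (x - y) * cis (- (x \<bullet> \<xi>))) = k y * cis (- (y \<bullet> \<xi>)) * fourier g \<xi>"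
      by (simp add: fourier_def)
  qed
  finally show "fourier (convol k g) \<xi> = fourier k \<xi> * fourier g \<xi>"
    by (simp add: fourier_def)
qed

lemma
  fixes k g :: "'a::euclidean_space \<Rightarrow> complex"
  assumes k: "integrable lborel k" and g: "continuous_on UNIV g" and M: "\<And>x. cmod (g x) \<le> M"
  shows continuous_convol: "continuous_on UNIV (convol k g)"
    and norm_convol_le: "cmod (convol k g x) \<le> M * (LINT y|lborel. cmod (k y))"
proof -
  have [measurable]: "k \<in> borel_measurable borel" "g \<in> borel_measurable borel"
    using integrable_borelD[OF k] borel_measurable_continuous_onI[OF g] by auto
  have dom: "integrable lborel (\<lambda>y. M * cmod (k y))" using k by simp
  have le: "cmod (k y * g (x - y)) \<le> M * cmod (k y)" for x y
    using mult_left_mono[OF M norm_ge_zero] by (simp add: norm_mult mult.commute)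
  show "continuous_on UNIV (convol k g)"
    unfolding continuous_on_sequentially
  proof (intro ballI allI impI)
    fix u x assume "(\<forall>n. u n \<in> UNIV) \<and> u \<longlonglongrightarrow> (x::'a)"
    then have u: "u \<longlonglongrightarrow> x" by simp
    show "(convol k g \<circ> u) \<longlonglongrightarrow> convol k g x"
      unfolding convol_def o_def
    proof (rule integral_dominated_convergence[OF _ _ dom])
      have "(\<lambda>n. g (u n - y)) \<longlonglongrightarrow> g (x - y)" for y
        by (rule isCont_tendsto_compose[of "x - y" g]) (use g in \<open>auto simp: continuous_on_eq_continuous_at intro!: tendsto_intros u\<close>)
      then show "AE y in lborel. (\<lambda>n. k y * g (u n - y)) \<longlonglongrightarrow> k y * g (x - y)"
        by (intro AE_I2 tendsto_intros)
    qed (use le in auto)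
  qed
  have "cmod (convol k g x) \<le> (LINT y|lborel. M * cmod (k y))"
    unfolding convol_def
    by (intro Bochner_Integration.integral_norm_bound_integral Bochner_Integration.integrable_bound[OF dom] dom)
       (use le in \<open>auto intro!: AE_I2 order.trans[OF _ abs_ge_self]\<close>)
  then show "cmod (convol k g x) \<le> M * (LINT y|lborel. cmod (k y))" by simp
qed

lemma integral_odd_eq_0:
  fixes f :: "'a::euclidean_space \<Rightarrow> 'b::{banach, second_countable_topology}"
  assumes [measurable]: "f \<in> borel_measurable borel" and odd: "\<And>x. f (- x) = - f x"
  shows "(LINT x|lborel. f x) = 0"
proof -
  have "(LINT x|lborel. f x) = - (LINT x|lborel. f x)"
    using integral_lborel_affine[of f "-1" 0] by (simp add: odd)
  then show ?thesis
    by (metis (no_types) add_eq_0_iff real_vector_eq_affinity scaleR_2 scale_eq_0_iff zero_neq_numeral)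
qed

lemma bounded_differentiable_imp_lipschitz_at:
  fixes g :: "'a::euclidean_space \<Rightarrow> complex"
  assumes d: "g differentiable (at x)" and M: "\<And>x. cmod (g x) \<le> M"
  obtains L where "L \<ge> 0" "\<And>y. cmod (g (x - y) - g x) \<le> L * norm y"
proof -
  obtain g' where g': "(g has_derivative g') (at x)" using d by (auto simp: differentiable_def)
  then have bl: "bounded_linear g'" by (rule has_derivative_bounded_linear)
  obtain B where B: "B > 0" "\<And>h. norm (g' h) \<le> norm h * B"
    using bounded_linear.pos_bounded[OF bl] by auto
  from g' obtain d where d: "d > 0" "\<And>z. norm (z - x) < d \<Longrightarrow> norm (g z - g x - g' (z - x)) \<le> 1 * norm (z - x)"
    unfolding has_derivative_at_alt by (metis zero_less_one)
  have M0: "M \<ge> 0" using M[of 0] norm_ge_zero order.trans by blast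
  show ?thesis
  proof (rule that[of "1 + B + 2 * M / d"])
    show "1 + B + 2 * M / d \<ge> 0" using B d M0 by simp
    fix y
    show "cmod (g (x - y) - g x) \<le> (1 + B + 2 * M / d) * norm y"
    proof (cases "norm y < d")
      case True
      have "cmod (g (x - y) - g x) \<le> norm (g (x - y) - g x - g' (- y)) + norm (g' (- y))"
        by (metis diff_add_cancel norm_triangle_ineq)
      also have "\<dots> \<le> norm y + norm y * B"
        using d(2)[of "x - y"] True B(2)[of "- y"] by simp
      also have "\<dots> \<le> (1 + B + 2 * M / d) * norm y"
        using M0 d(1) by (simp add: algebra_simps)
      finally show ?thesis .
    next
      case False
      have "cmod (g (x - y) - g x) \<le> M + M"
        using norm_triangle_ineq4[of "g (x - y)" "g x"] M[of "x - y"] M[of x] by linarith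
      also have "\<dots> = 2 * M / d * d" using d(1) by simp
      also have "\<dots> \<le> 2 * M / d * norm y"
        using False M0 d(1) by (intro mult_left_mono) auto
      also have "\<dots> \<le> (1 + B + 2 * M / d) * norm y"
        using B(1) by (intro mult_right_mono) auto
      finally show ?thesis .
    qed
  qed
qed

text \<open>
The regularised form of the principal value: as the kernel is odd, subtracting \<open>g x\<close> on the unit
ball changes none of the truncated integrals and makes the limit an absolutely convergent integral.
\<close>

definition riesz_transform :: "'a::euclidean_space \<Rightarrow> ('a \<Rightarrow> complex) \<Rightarrow> 'a \<Rightarrow> complex"
  where "riesz_transform e g x =
    (LINT y|lborel. complex_of_real (riesz_kernel e y) * (g (x - y) - complex_of_real (indicator (cball 0 1) y) * g x))"

text \<open>
On the unit ball the difference \<open>g (x - y) - g x\<close> gains a factor \<open>|y|\<close>; outside, the kernel is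
bounded and \<open>g\<close> is integrable.
\<close>

lemma riesz_transform_integrable:
  fixes g :: "'a::euclidean_space \<Rightarrow> complex"
  assumes e: "e \<in> Basis" and g: "integrable lborel g" and M: "\<And>x. cmod (g x) \<le> M"
    and diff: "g differentiable (at x)"
  shows "integrable lborel (\<lambda>y. complex_of_real (riesz_kernel e y) * (g (x - y) - complex_of_real (indicator (cball 0 1) y) * g x))"
proof -
  have [measurable]: "g \<in> borel_measurable borel" by (rule integrable_borelD[OF g])
  have [measurable]: "cball (0::'a) 1 \<in> sets borel" by simp
  obtain L where L: "L \<ge> 0" "\<And>y. cmod (g (x - y) - g x) \<le> L * norm y"
    using bounded_differentiable_imp_lipschitz_at[OF diff M] by blast
  let ?c = "riesz_const DIM('a)"
  let ?D = "\<lambda>y. L * \<bar>indicator (cball 0 1) y * (norm y * riesz_kernel e y)\<bar> + ?c * cmod (g (x - y))"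
  have gx: "integrable lborel (\<lambda>y. g (x - y))"
    using integrable_lborel_affine[of g "-1" x] g by simp
  have D: "integrable lborel ?D"
    using integrable_norm_riesz_kernel_ball[OF e] gx by (intro Bochner_Integration.integrable_add integrable_mult_right integrable_norm integrable_abs)
  have "cmod (complex_of_real (riesz_kernel e y) * (g (x - y) - complex_of_real (indicator (cball 0 1) y) * g x)) \<le> ?D y" for y
  proof (cases "norm y \<le> 1")
    case True
    have "\<bar>riesz_kernel e y\<bar> * cmod (g (x - y) - g x) \<le> \<bar>riesz_kernel e y\<bar> * (L * norm y)"
      by (intro mult_left_mono L) simp
    moreover have "0 \<le> ?c * cmod (g (x - y))" using riesz_const_nonneg by simp
    ultimately show ?thesis
      using True by (simp add: norm_mult abs_mult mem_cball_0 mult_ac)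
  next
    case False
    have "\<bar>y \<bullet> e\<bar> \<le> norm y" by (rule Basis_le_norm[OF e])
    also have "norm y \<le> norm y ^ (DIM('a) + 1)" using False by (intro self_le_power) auto
    finally have "\<bar>y \<bullet> e\<bar> / norm y ^ (DIM('a) + 1) \<le> 1"
      by (simp add: divide_le_eq)
    then have "?c * (\<bar>y \<bullet> e\<bar> / norm y ^ (DIM('a) + 1)) \<le> ?c * 1"
      by (intro mult_left_mono riesz_const_nonneg)
    then have "\<bar>riesz_kernel e y\<bar> \<le> ?c"
      using riesz_const_nonneg[of "DIM('a)"] by (simp add: riesz_kernel_def abs_mult)
    from mult_right_mono[OF this norm_ge_zero] show ?thesis
      using False by (simp add: norm_mult mem_cball_0)
  qed
  then show ?thesis
    by (intro Bochner_Integration.integrable_bound[OF D]) (auto intro!: AE_I2 order.trans[OF _ abs_ge_self])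
qed

lemma convol_riesz_trunc_tendsto:
  fixes g :: "'a::euclidean_space \<Rightarrow> complex"
  assumes e: "e \<in> Basis" and g: "integrable lborel g" and M: "\<And>x. cmod (g x) \<le> M"
    and diff: "g differentiable (at x)"
  shows "(\<lambda>m. convol (\<lambda>y. complex_of_real (riesz_trunc m e y)) g x) \<longlonglongrightarrow> riesz_transform e g x"
proof -
  have [measurable]: "g \<in> borel_measurable borel" by (rule integrable_borelD[OF g])
  have [measurable]: "cball (0::'a) 1 \<in> sets borel" by simp
  let ?\<phi> = "\<lambda>y. g (x - y) - complex_of_real (indicator (cball 0 1) y) * g x"
  note int = riesz_transform_integrable[OF e g M diff]
  \<comment> \<open>The truncated kernel is integrable and odd, so it does not see the constant g x on the ball.\<close>
  have eq: "convol (\<lambda>y. complex_of_real (riesz_trunc m e y)) g x = (LINT y|lborel. riesz_trunc m e y * ?\<phi> y)" for m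
  proof -
    let ?k = "\<lambda>y. complex_of_real (riesz_trunc m e y)"
    note ik = integrable_riesz_trunc[OF e, of m]
    have i1: "integrable lborel (\<lambda>y. ?k y * g (x - y))"
      by (rule Bochner_Integration.integrable_bound[where f = "\<lambda>y. complex_of_real M * ?k y"])
         (use ik M in \<open>auto simp: norm_mult mult.commute[of "\<bar>riesz_trunc m e _\<bar>"] intro!: AE_I2 mult_right_mono order.trans[OF M abs_ge_self]\<close>)
    have i2: "integrable lborel (\<lambda>y. ?k y * (complex_of_real (indicator (cball 0 1) y) * g x))"
      by (rule Bochner_Integration.integrable_bound[where f = "\<lambda>y. g x * ?k y"])
         (use ik in \<open>auto simp: norm_mult split: split_indicator\<close>)
    have "(LINT y|lborel. ?k y * (complex_of_real (indicator (cball 0 1) y) * g x)) = 0"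
      by (rule integral_odd_eq_0) (auto simp: riesz_trunc_minus mem_cball_0 indicator_def)
    then show ?thesis
      unfolding convol_def right_diff_distrib by (subst Bochner_Integration.integral_diff[OF i1 i2]) simp
  qed
  show ?thesis
    unfolding eq riesz_transform_def
  proof (rule integral_dominated_convergence)
    show "integrable lborel (\<lambda>y. norm (riesz_kernel e y * ?\<phi> y))"
      using int by (rule integrable_norm)
    show "AE y in lborel. (\<lambda>m. riesz_trunc m e y * ?\<phi> y) \<longlonglongrightarrow> riesz_kernel e y * ?\<phi> y"
      by (intro AE_I2 tendsto_intros riesz_trunc_tendsto)
    show "AE y in lborel. norm (riesz_trunc m e y * ?\<phi> y) \<le> norm (riesz_kernel e y * ?\<phi> y)" for m
      by (intro AE_I2) (auto simp: norm_mult intro!: mult_right_mono riesz_trunc_le)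
  qed auto
qed

lemma riesz_principal_value:
  fixes g :: "'a::euclidean_space \<Rightarrow> complex"
  assumes e: "e \<in> Basis" and g: "integrable lborel g" and M: "\<And>x. cmod (g x) \<le> M"
    and diff: "g differentiable (at x)"
  shows "((\<lambda>\<epsilon>. LINT y|lborel. indicator {y. \<epsilon> \<le> norm (x - y)} y *\<^sub>R (riesz_kernel e (x - y) * g y))
      \<longlongrightarrow> riesz_transform e g x) (at_right 0)"
proof -
  have [measurable]: "g \<in> borel_measurable borel" by (rule integrable_borelD[OF g])
  have [measurable]: "cball (0::'a) 1 \<in> sets borel" by simp
  let ?\<phi> = "\<lambda>y. g (x - y) - complex_of_real (indicator (cball 0 1) y) * g x"
  note int = riesz_transform_integrable[OF e g M diff]
  have [measurable]: "{y. \<epsilon> \<le> norm (y::'a)} \<in> sets borel" "{y. \<epsilon> \<le> norm (x - y)} \<in> sets borel" for \<epsilon> by measurable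
  have eq: "(LINT y|lborel. indicator {y. \<epsilon> \<le> norm (x - y)} y *\<^sub>R (riesz_kernel e (x - y) * g y)) =
     (LINT y|lborel. indicator {y. \<epsilon> \<le> norm y} y *\<^sub>R (riesz_kernel e y * ?\<phi> y))" if \<epsilon>: "\<epsilon> > 0" for \<epsilon>
  proof -
    let ?I = "\<lambda>y. complex_of_real (indicator {y. \<epsilon> \<le> norm y} y)"
    \<comment> \<open>?Z is the part that oddness removes; cutting out the small ball makes it integrable.\<close>
    let ?Z = "\<lambda>y. ?I y * (complex_of_real (riesz_kernel e y) * (complex_of_real (indicator (cball 0 1) y) * g x))"
    have i1: "integrable lborel (\<lambda>y. ?I y * (riesz_kernel e y * ?\<phi> y))"
      by (rule Bochner_Integration.integrable_bound[OF int]) (auto simp: norm_mult split: split_indicator)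
    have i2: "integrable lborel ?Z"
    proof (rule Bochner_Integration.integrable_bound)
      show "integrable lborel (\<lambda>y. (cmod (g x) / \<epsilon>) * (indicator (cball 0 1) y * (norm y * riesz_kernel e y)))"
        by (intro integrable_mult_right integrable_norm_riesz_kernel_ball e)
      have "norm (?Z y) \<le> norm ((cmod (g x) / \<epsilon>) * (indicator (cball 0 1) y * (norm y * riesz_kernel e y)))" for y
      proof (cases "\<epsilon> \<le> norm y \<and> y \<in> cball 0 1")
        case True
        then have "1 * (cmod (g x) * \<bar>riesz_kernel e y\<bar>) \<le> (norm y / \<epsilon>) * (cmod (g x) * \<bar>riesz_kernel e y\<bar>)"
          using \<epsilon> by (intro mult_right_mono) auto
        then show ?thesis using True \<epsilon> by (simp add: norm_mult abs_mult mult_ac)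
      qed (auto split: split_indicator)
      then show "AE y in lborel. norm (?Z y) \<le> norm ((cmod (g x) / \<epsilon>) * (indicator (cball 0 1) y * (norm y * riesz_kernel e y)))"
        by simp
    qed measurable
    have z: "(LINT y|lborel. ?Z y) = 0"
      by (rule integral_odd_eq_0) (auto simp: riesz_kernel_minus mem_cball_0 indicator_def)
    have "(LINT y|lborel. indicator {y. \<epsilon> \<le> norm (x - y)} y *\<^sub>R (riesz_kernel e (x - y) * g y)) =
        (LINT y|lborel. ?I y * (riesz_kernel e y * g (x - y)))"
      by (subst integral_lborel_affine[where c = "-1" and t = x])
         (auto simp: scaleR_conv_of_real indicator_def intro!: Bochner_Integration.integral_cong)
    also have "\<dots> = (LINT y|lborel. ?I y * (riesz_kernel e y * ?\<phi> y) + ?Z y)"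
      by (intro Bochner_Integration.integral_cong refl) (simp add: algebra_simps)
    also have "\<dots> = (LINT y|lborel. ?I y * (riesz_kernel e y * ?\<phi> y))"
      by (subst Bochner_Integration.integral_add[OF i1 i2]) (simp add: z)
    finally show ?thesis by (simp add: scaleR_conv_of_real)
  qed
  have "((\<lambda>\<epsilon>. LINT y|lborel. indicator {y. \<epsilon> \<le> norm y} y *\<^sub>R (riesz_kernel e y * ?\<phi> y)) \<longlongrightarrow> riesz_transform e g x) (at_right 0)"
    unfolding tendsto_at_iff_sequentially o_def
  proof (intro allI impI)
    fix u :: "nat \<Rightarrow> real" assume u: "\<forall>i. u i \<in> {0<..} - {0}" "u \<longlonglongrightarrow> 0"
    show "(\<lambda>i. LINT y|lborel. indicator {y. u i \<le> norm y} y *\<^sub>R (riesz_kernel e y * ?\<phi> y)) \<longlonglongrightarrow> riesz_transform e g x"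
      unfolding riesz_transform_def
    proof (rule integral_dominated_convergence)
      show "integrable lborel (\<lambda>y. norm (riesz_kernel e y * ?\<phi> y))"
        using int by (rule integrable_norm)
      show "AE y in lborel. (\<lambda>i. indicator {y. u i \<le> norm y} y *\<^sub>R (riesz_kernel e y * ?\<phi> y)) \<longlonglongrightarrow> riesz_kernel e y * ?\<phi> y"
      proof (intro AE_I2)
        fix y :: 'a
        show "(\<lambda>i. indicator {y. u i \<le> norm y} y *\<^sub>R (riesz_kernel e y * ?\<phi> y)) \<longlonglongrightarrow> riesz_kernel e y * ?\<phi> y"
        proof (cases "y = 0")
          case False
          then have "\<forall>\<^sub>F i in sequentially. u i < norm y"
            using order_tendstoD(2)[OF u(2)] by simp
          then show ?thesis
            by (intro tendsto_eventually) (auto elim!: eventually_mono)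
        qed (simp add: riesz_kernel_def)
      qed
      show "AE y in lborel. norm (indicator {y. u i \<le> norm y} y *\<^sub>R (riesz_kernel e y * ?\<phi> y)) \<le> norm (riesz_kernel e y * ?\<phi> y)" for i
        by (intro AE_I2) (auto split: split_indicator)
    qed auto
  qed
  then show ?thesis
    by (rule Lim_transform_eventually) (use eq in \<open>auto simp: eventually_at_right_less intro!: eventually_mono[OF eventually_at_right_less[of 0]]\<close>)
qed

section \<open>The Riesz transform as a Fourier multiplier\<close>

lemma nn_integral_square_triangle:
  fixes a b c :: "'a \<Rightarrow> complex"
  assumes [measurable]: "a \<in> borel_measurable M" "b \<in> borel_measurable M" "c \<in> borel_measurable M"
  shows "(\<integral>\<^sup>+x. ennreal ((cmod (a x - c x))\<^sup>2) \<partial>M) \<le>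
    2 * (\<integral>\<^sup>+x. ennreal ((cmod (a x - b x))\<^sup>2) \<partial>M) + 2 * (\<integral>\<^sup>+x. ennreal ((cmod (b x - c x))\<^sup>2) \<partial>M)"
proof -
  have "(cmod (u - w))\<^sup>2 \<le> 2 * (cmod (u - v))\<^sup>2 + 2 * (cmod (v - w))\<^sup>2" for u v w
  proof -
    have "cmod (u - w) \<le> cmod (u - v) + cmod (v - w)" by norm
    then have "(cmod (u - w))\<^sup>2 \<le> (cmod (u - v) + cmod (v - w))\<^sup>2" by (rule power_mono) simp
    also have "\<dots> \<le> 2 * (cmod (u - v))\<^sup>2 + 2 * (cmod (v - w))\<^sup>2"
      using sum_squares_bound[of "cmod (u - v)" "cmod (v - w)"] by (simp add: power2_sum)
    finally show ?thesis .
  qed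
  then have "ennreal ((cmod (u - w))\<^sup>2) \<le> 2 * ennreal ((cmod (u - v))\<^sup>2) + 2 * ennreal ((cmod (v - w))\<^sup>2)" for u v w
    by (simp flip: ennreal_numeral ennreal_mult ennreal_plus add: ennreal_leI)
  then have "(\<integral>\<^sup>+x. ennreal ((cmod (a x - c x))\<^sup>2) \<partial>M) \<le>
      (\<integral>\<^sup>+x. 2 * ennreal ((cmod (a x - b x))\<^sup>2) + 2 * ennreal ((cmod (b x - c x))\<^sup>2) \<partial>M)"
    by (intro nn_integral_mono)
  then show ?thesis by (simp add: nn_integral_add nn_integral_cmult)
qed

lemma nn_integral_square_finite_of_bounded:
  fixes g :: "'a \<Rightarrow> complex"
  assumes g: "integrable M g" and C: "\<And>x. cmod (g x) \<le> C"
  shows "(\<integral>\<^sup>+x. ennreal ((cmod (g x))\<^sup>2) \<partial>M) < \<infinity>"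
proof -
  have "(cmod (g x))\<^sup>2 \<le> norm (complex_of_real C * g x)" for x
    using C[of x] norm_ge_zero[of "g x"] by (auto simp: power2_eq_square norm_mult intro!: mult_right_mono)
  then have "(\<integral>\<^sup>+x. ennreal ((cmod (g x))\<^sup>2) \<partial>M) \<le> (\<integral>\<^sup>+x. ennreal (norm (complex_of_real C * g x)) \<partial>M)"
    by (intro nn_integral_mono ennreal_leI)
  also have "\<dots> < \<infinity>"
    using g by (intro has_bochner_integral_implies_finite_norm[OF has_bochner_integral_integrable]) simp
  finally show ?thesis .
qed

lemma measurable_riesz_mult [measurable]: "riesz_mult e \<in> borel_measurable borel"
  unfolding riesz_mult_def[abs_def] by measurable

lemma norm_riesz_mult_le: "e \<in> Basis \<Longrightarrow> cmod (riesz_mult e \<xi>) \<le> 1"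
  using Basis_le_norm[of e \<xi>] by (auto simp: riesz_mult_def norm_mult norm_divide divide_le_eq)

lemma measurable_riesz_transform [measurable]:
  assumes [measurable]: "g \<in> borel_measurable borel"
  shows "riesz_transform e g \<in> borel_measurable borel"
proof -
  have [measurable]: "cball (0::'a) 1 \<in> sets borel" by simp
  show ?thesis unfolding riesz_transform_def[abs_def] by measurable
qed

lemma fourier_convol_riesz_trunc_L2:
  fixes g :: "'a::euclidean_space \<Rightarrow> complex"
  assumes e: "e \<in> Basis" and g: "integrable lborel g" and M: "\<And>x. cmod (g x) \<le> M"
  shows "(\<lambda>m. \<integral>\<^sup>+\<xi>. ennreal ((cmod (fourier (convol (\<lambda>y. complex_of_real (riesz_trunc m e y)) g) \<xi> -
      riesz_mult e \<xi> * fourier g \<xi>))\<^sup>2) \<partial>lborel) \<longlonglongrightarrow> 0"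
proof -
  have [measurable]: "g \<in> borel_measurable borel" by (rule integrable_borelD[OF g])
  let ?k = "\<lambda>m. fourier (\<lambda>y. complex_of_real (riesz_trunc m e y))"
  let ?u = "\<lambda>m \<xi>. ennreal ((cmod ((?k m \<xi> - riesz_mult e \<xi>) * fourier g \<xi>))\<^sup>2)"
  have eq: "fourier (convol (\<lambda>y. complex_of_real (riesz_trunc m e y)) g) \<xi> - riesz_mult e \<xi> * fourier g \<xi> =
      (?k m \<xi> - riesz_mult e \<xi>) * fourier g \<xi>" for m \<xi>
    by (simp add: fourier_convol integrable_riesz_trunc e g algebra_simps)
  have "(\<lambda>m. \<integral>\<^sup>+\<xi>. ?u m \<xi> \<partial>lborel) \<longlonglongrightarrow> (\<integral>\<^sup>+\<xi>. 0 \<partial>(lborel::'a measure))"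
  proof (rule nn_integral_dominated_convergence)
    show "(\<integral>\<^sup>+\<xi>. 4 * ennreal ((cmod (fourier g \<xi>))\<^sup>2) \<partial>lborel) < \<infinity>"
      using le_less_trans[OF plancherel_le[OF g]] nn_integral_square_finite_of_bounded[OF g M]
      by (simp add: nn_integral_cmult ennreal_mult_less_top)
    show "AE \<xi> in lborel. ?u m \<xi> \<le> 4 * ennreal ((cmod (fourier g \<xi>))\<^sup>2)" for m
    proof (intro AE_I2)
      fix \<xi>
      have "cmod (?k m \<xi> - riesz_mult e \<xi>) \<le> 1 + 1"
        using norm_triangle_ineq4[of "?k m \<xi>" "riesz_mult e \<xi>"] norm_fourier_riesz_trunc_le[OF e] norm_riesz_mult_le[OF e]
        by (meson add_mono order.trans)
      then have "(cmod (?k m \<xi> - riesz_mult e \<xi>))\<^sup>2 \<le> (1 + 1)\<^sup>2" by (rule power_mono) simp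
      from mult_right_mono[OF this zero_le_power2[of "cmod (fourier g \<xi>)"]]
      have "(cmod ((?k m \<xi> - riesz_mult e \<xi>) * fourier g \<xi>))\<^sup>2 \<le> 4 * (cmod (fourier g \<xi>))\<^sup>2"
        by (simp add: norm_mult power_mult_distrib)
      then show "?u m \<xi> \<le> 4 * ennreal ((cmod (fourier g \<xi>))\<^sup>2)"
        by (simp flip: ennreal_numeral ennreal_mult add: ennreal_leI)
    qed
    show "AE \<xi> in lborel. (\<lambda>m. ?u m \<xi>) \<longlonglongrightarrow> 0"
    proof (intro AE_I2)
      fix \<xi>
      have "(\<lambda>m. (cmod ((?k m \<xi> - riesz_mult e \<xi>) * fourier g \<xi>))\<^sup>2) \<longlonglongrightarrow> (cmod ((riesz_mult e \<xi> - riesz_mult e \<xi>) * fourier g \<xi>))\<^sup>2"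
        by (intro tendsto_intros fourier_riesz_trunc_tendsto e)
      from tendsto_ennrealI[OF this] show "(\<lambda>m. ?u m \<xi>) \<longlonglongrightarrow> 0" by simp
    qed
  qed measurable
  then show ?thesis unfolding eq by simp
qed

text \<open>
Distances between two approximations are controlled, through the lower Plancherel inequality, by
their transforms, which converge. Fatou's lemma, applied as the second index tends to infinity,
replaces the second approximation by its pointwise limit.
\<close>

lemma convol_riesz_trunc_L2:
  fixes g :: "'a::euclidean_space \<Rightarrow> complex"
  assumes e: "e \<in> Basis" and g: "integrable lborel g" and M: "\<And>x. cmod (g x) \<le> M"
    and diff: "\<And>x. g differentiable (at x)"
  shows "(\<lambda>m. \<integral>\<^sup>+x. ennreal ((cmod (convol (\<lambda>y. complex_of_real (riesz_trunc m e y)) g x -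
      riesz_transform e g x))\<^sup>2) \<partial>lborel) \<longlonglongrightarrow> 0"
proof -
  have [measurable]: "g \<in> borel_measurable borel" by (rule integrable_borelD[OF g])
  have cont: "continuous_on UNIV g"
    using diff by (simp add: continuous_on_eq_continuous_at differentiable_imp_continuous_within)
  define h where "h = (\<lambda>m. convol (\<lambda>y. complex_of_real (riesz_trunc m e y)) g)"
  have [measurable]: "h m \<in> borel_measurable borel" for m unfolding h_def by measurable
  have ih: "integrable lborel (h m)" for m
    unfolding h_def by (intro integrable_convol integrable_riesz_trunc e g)
  define A where "A = (\<lambda>m. \<integral>\<^sup>+\<xi>. ennreal ((cmod (fourier (h m) \<xi> - riesz_mult e \<xi> * fourier g \<xi>))\<^sup>2) \<partial>lborel)"
  have A: "A \<longlonglongrightarrow> 0"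
    unfolding A_def h_def by (rule fourier_convol_riesz_trunc_L2[OF e g M])
  define N where "N = (2 * pi) ^ DIM('a)"
  have N: "N > 0" by (simp add: N_def)
  define c where "c = ennreal (1 / N)"
  have cN: "c * ennreal N = 1" using N by (simp add: c_def flip: ennreal_mult)
  have c: "c \<noteq> 0" "c \<noteq> \<infinity>" using cN by (auto simp: c_def)
  have dist: "(\<integral>\<^sup>+x. ennreal ((cmod (h m x - h k x))\<^sup>2) \<partial>lborel) \<le> c * (2 * A m + 2 * A k)" for m k
  proof -
    let ?d = "\<lambda>x. h m x - h k x"
    have F: "fourier ?d \<xi> = fourier (h m) \<xi> - fourier (h k) \<xi>" for \<xi>
      unfolding fourier_def left_diff_distrib
      by (intro Bochner_Integration.integral_diff) (use integrable_times_cis[OF ih, of _ "-\<xi>"] in \<open>simp_all\<close>)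
    obtain B where B: "\<And>x. cmod (?d x) \<le> B"
    proof
      fix x
      show "cmod (?d x) \<le> M * (LINT y|lborel. cmod (complex_of_real (riesz_trunc m e y))) + M * (LINT y|lborel. cmod (complex_of_real (riesz_trunc k e y)))"
        unfolding h_def
        by (rule order.trans[OF norm_triangle_ineq4]) (intro add_mono norm_convol_le integrable_riesz_trunc e cont M)
    qed
    have "ennreal N * (\<integral>\<^sup>+x. ennreal ((cmod (?d x))\<^sup>2) \<partial>lborel) \<le> (\<integral>\<^sup>+\<xi>. ennreal ((cmod (fourier ?d \<xi>))\<^sup>2) \<partial>lborel)"
      unfolding N_def
    proof (rule plancherel_ge[OF _ _ B])
      show "integrable lborel ?d" by (intro Bochner_Integration.integrable_diff ih)
      show "continuous_on UNIV ?d"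
        unfolding h_def by (intro continuous_intros continuous_convol[OF _ cont M] integrable_riesz_trunc e)
    qed
    also have "\<dots> \<le> 2 * A m + 2 * (\<integral>\<^sup>+\<xi>. ennreal ((cmod (riesz_mult e \<xi> * fourier g \<xi> - fourier (h k) \<xi>))\<^sup>2) \<partial>lborel)"
      unfolding A_def F by (rule nn_integral_square_triangle) measurable
    also have "(\<integral>\<^sup>+\<xi>. ennreal ((cmod (riesz_mult e \<xi> * fourier g \<xi> - fourier (h k) \<xi>))\<^sup>2) \<partial>lborel) = A k"
      unfolding A_def by (simp add: norm_minus_commute)
    finally have "c * (ennreal N * (\<integral>\<^sup>+x. ennreal ((cmod (?d x))\<^sup>2) \<partial>lborel)) \<le> c * (2 * A m + 2 * A k)"
      by (rule mult_left_mono) simp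
    then show ?thesis by (simp add: mult.assoc[symmetric] cN)
  qed
  have le: "(\<integral>\<^sup>+x. ennreal ((cmod (h m x - riesz_transform e g x))\<^sup>2) \<partial>lborel) \<le> c * (2 * A m)" for m
  proof (rule fatou_tendsto_bound[OF _ _ dist])
    show "(\<lambda>k. ennreal ((cmod (h m x - h k x))\<^sup>2)) \<longlonglongrightarrow> ennreal ((cmod (h m x - riesz_transform e g x))\<^sup>2)" for x
      unfolding h_def by (intro tendsto_ennrealI tendsto_intros convol_riesz_trunc_tendsto[OF e g M diff])
    have "(\<lambda>k. c * (2 * A m + 2 * A k)) \<longlonglongrightarrow> c * (2 * A m + 2 * 0)"
      by (intro tendsto_mult_ennreal tendsto_add tendsto_const A) (use c in auto)
    then show "(\<lambda>k. c * (2 * A m + 2 * A k)) \<longlonglongrightarrow> c * (2 * A m)" by simp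
  qed measurable
  have lim: "(\<lambda>m. c * (2 * A m)) \<longlonglongrightarrow> c * (2 * 0)"
    by (intro tendsto_mult_ennreal tendsto_const A) (use c in auto)
  show ?thesis
    by (rule tendsto_sandwich[OF _ _ tendsto_const]) (use le lim in \<open>auto simp: h_def\<close>)
qed

section \<open>The fractional Fourier transform on square integrable functions\<close>

lemma chirp_eq_cis: "chirp \<alpha> x = cis ((\<Sum>k\<in>UNIV. (x $ k)\<^sup>2 * cot (\<alpha> $ k)) / 2)"
  by (simp add: chirp_def cis_conv_exp)

lemma norm_chirp [simp]: "cmod (chirp \<alpha> x) = 1"
  by (simp add: chirp_eq_cis)

lemma measurable_chirp [measurable]: "chirp \<alpha> \<in> borel_measurable borel"
  unfolding chirp_eq_cis[abs_def] by measurable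

lemma chirp_minus_mult: "chirp (- \<alpha>) x * chirp \<alpha> x = 1"
  by (simp add: chirp_eq_cis cis_mult sum_negf)

lemma chirp_differentiable: "chirp \<alpha> differentiable (at x)"
proof -
  let ?q = "\<lambda>x. (\<Sum>k\<in>UNIV. (x $ k)\<^sup>2 * cot (\<alpha> $ k)) * (1 / 2)"
  have "?q differentiable (at x)"
    by (intro differentiable_mult differentiable_sum differentiable_power differentiable_const
        bounded_linear_imp_differentiable bounded_linear_vec_nth finite ballI)
  moreover have "cis differentiable (at (?q x))"
    using has_vector_derivative_iexp[of "?q x" UNIV]
    by (auto simp: cis_conv_exp[abs_def] has_vector_derivative_def differentiable_def)
  ultimately have "(cis \<circ> ?q) differentiable (at x)"
    by (rule differentiable_chain_at)
  then show ?thesis by (simp add: chirp_eq_cis[abs_def] o_def)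
qed

lemma borel_measurable_lebesgueI: "F \<in> borel_measurable borel \<Longrightarrow> F \<in> borel_measurable lebesgue"
  by (rule measurable_completion) simp

lemma sum_mult_csc_eq_inner:
  "(\<Sum>k\<in>UNIV. x $ k * u $ k * csc (\<alpha> $ k)) = x \<bullet> csc_scale \<alpha> u"
  by (simp add: inner_vec_def csc_scale_def mult.assoc)

lemma measurable_csc_scale [measurable]: "csc_scale \<alpha> \<in> borel_measurable borel"
proof -
  have "linear (csc_scale \<alpha>)"
    by (rule linearI) (simp_all add: csc_scale_def vec_eq_iff algebra_simps)
  then show ?thesis by (intro borel_measurable_continuous_onI linear_continuous_on linear_conv_bounded_linear[THEN iffD1])
qed

lemma nn_integral_csc_scale:
  fixes \<alpha> :: "real^'n"
  assumes \<alpha>: "\<And>k. sin (\<alpha> $ k) \<noteq> 0"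
  obtains J :: real where "J \<ge> 0"
    "\<And>F. F \<in> borel_measurable borel \<Longrightarrow> (\<integral>\<^sup>+u. F (csc_scale \<alpha> u) \<partial>lborel) = ennreal J * (\<integral>\<^sup>+\<xi>. F \<xi> \<partial>lborel)"
proof -
  define c where "c = (\<lambda>b::real^'n. (\<chi> k. csc (\<alpha> $ k)) \<bullet> b)"
  have c0: "c b \<noteq> 0" if "b \<in> Basis" for b
    using that \<alpha> by (auto simp: Basis_vec_def c_def inner_axis csc_def)
  have T: "0 + (\<Sum>b\<in>Basis. (c b * (x \<bullet> b)) *\<^sub>R b) = csc_scale \<alpha> x" for x
  proof (rule euclidean_eqI)
    fix b :: "real^'n" assume b: "b \<in> Basis"
    then show "(0 + (\<Sum>b\<in>Basis. (c b * (x \<bullet> b)) *\<^sub>R b)) \<bullet> b = csc_scale \<alpha> x \<bullet> b"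
      by (auto simp: inner_sum_left inner_Basis if_distrib c_def Basis_vec_def inner_axis csc_scale_def cong: if_cong)
  qed
  define P where "P = (\<Prod>b\<in>Basis. \<bar>c b\<bar>)"
  have P: "P > 0" unfolding P_def using c0 by (intro prod_pos) auto
  have eq: "lborel = density (distr lborel borel (csc_scale \<alpha>)) (\<lambda>_. ennreal P)"
    using lborel_affine_euclidean[of c 0, OF c0] unfolding T P_def by simp
  show ?thesis
  proof (rule that[of "1 / P"])
    show "1 / P \<ge> 0" using P by simp
    fix F :: "real^'n \<Rightarrow> ennreal" assume [measurable]: "F \<in> borel_measurable borel"
    have "(\<integral>\<^sup>+\<xi>. F \<xi> \<partial>lborel) = ennreal P * (\<integral>\<^sup>+u. F (csc_scale \<alpha> u) \<partial>lborel)"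
      by (subst eq) (simp add: nn_integral_density nn_integral_distr nn_integral_cmult)
    then have "ennreal (1 / P) * (\<integral>\<^sup>+\<xi>. F \<xi> \<partial>lborel) = (ennreal (1 / P) * ennreal P) * (\<integral>\<^sup>+u. F (csc_scale \<alpha> u) \<partial>lborel)"
      by (simp add: mult.assoc)
    also have "ennreal (1 / P) * ennreal P = 1" using P by (simp flip: ennreal_mult)
    finally show "(\<integral>\<^sup>+u. F (csc_scale \<alpha> u) \<partial>lborel) = ennreal (1 / P) * (\<integral>\<^sup>+\<xi>. F \<xi> \<partial>lborel)" by simp
  qed
qed

definition frft_factor :: "real^'n::finite \<Rightarrow> complex"
  where "frft_factor \<alpha> = frft_const \<alpha> / complex_of_real (sqrt (2 * pi) ^ CARD('n))"

lemma frft_L1_lebesgue: "frft_L1 \<alpha> f u = frft_factor \<alpha> * chirp \<alpha> u *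
    (LINT x|lebesgue. f x * chirp \<alpha> x * cis (- (x \<bullet> csc_scale \<alpha> u)))"
  by (simp add: frft_L1_def frft_factor_def sum_mult_csc_eq_inner cis_conv_exp)

lemma frft_L1_eq_fourier:
  assumes [measurable]: "f \<in> borel_measurable borel"
  shows "frft_L1 \<alpha> f u = frft_factor \<alpha> * chirp \<alpha> u * fourier (\<lambda>x. f x * chirp \<alpha> x) (csc_scale \<alpha> u)"
  unfolding frft_L1_lebesgue fourier_def by (subst integral_completion) simp_all

lemma measurable_frft_L1:
  assumes [measurable]: "f \<in> borel_measurable borel"
  shows "frft_L1 \<alpha> f \<in> borel_measurable borel"
  unfolding frft_L1_eq_fourier[OF assms, abs_def] by measurable

lemma completion_ex_borel_measurable_complex:
  fixes h :: "'a \<Rightarrow> complex"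
  assumes [measurable]: "h \<in> borel_measurable (completion M)"
  obtains h' where "h' \<in> borel_measurable M" "AE x in M. h x = h' x"
proof -
  have "(\<lambda>x. Re (h x)) \<in> borel_measurable (completion M)" "(\<lambda>x. Im (h x)) \<in> borel_measurable (completion M)"
    by measurable
  from this[THEN completion_ex_borel_measurable_real] obtain a b where
    [measurable]: "a \<in> borel_measurable M" "b \<in> borel_measurable M" and
    ab: "AE x in M. Re (h x) = a x" "AE x in M. Im (h x) = b x" by blast
  show ?thesis
  proof (rule that[of "\<lambda>x. complex_of_real (a x) + \<i> * complex_of_real (b x)"])
    show "AE x in M. h x = complex_of_real (a x) + \<i> * complex_of_real (b x)"
      using ab by eventually_elim (simp add: complex_eq_iff)
  qed measurable
qed

text \<open>
Fubini's theorem is applied to Borel functions on \<open>lborel\<close>, while the fractional transform speaks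
of Lebesgue measurable ones; almost everywhere equal functions have the same transform.
\<close>

lemma integrable_lebesgue_borel_version:
  fixes h :: "real^'n::finite \<Rightarrow> complex"
  assumes h: "integrable lebesgue h"
  obtains h' where "integrable lborel h'" "AE x in lebesgue. h x = h' x" "frft_L1 \<alpha> h = frft_L1 \<alpha> h'"
proof -
  have hm [measurable]: "h \<in> borel_measurable lebesgue" using h by auto
  obtain h' where h' [measurable]: "h' \<in> borel_measurable lborel" and ae: "AE x in lborel. h x = h' x"
    using completion_ex_borel_measurable_complex[OF hm] by blast
  have h'm: "h' \<in> borel_measurable lebesgue" by (rule measurable_completion[OF h'])
  have ae': "AE x in lebesgue. h x = h' x" by (rule AE_completion[OF ae])
  have "integrable lebesgue h'" using integrable_cong_AE[OF hm h'm ae'] h by simp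
  then have "integrable lborel h'" by (simp add: integrable_completion)
  moreover have "frft_L1 \<alpha> h = frft_L1 \<alpha> h'"
  proof
    fix u
    have E: "(\<lambda>x. chirp \<alpha> x * cis (- (x \<bullet> csc_scale \<alpha> u))) \<in> borel_measurable lebesgue"
      by (rule measurable_completion) simp
    have "(LINT x|lebesgue. h x * chirp \<alpha> x * cis (- (x \<bullet> csc_scale \<alpha> u))) =
       (LINT x|lebesgue. h' x * chirp \<alpha> x * cis (- (x \<bullet> csc_scale \<alpha> u)))"
      unfolding mult.assoc
    proof (rule integral_cong_AE)
      show "AE x in lebesgue. h x * (chirp \<alpha> x * cis (- (x \<bullet> csc_scale \<alpha> u))) = h' x * (chirp \<alpha> x * cis (- (x \<bullet> csc_scale \<alpha> u)))"
        using ae' by eventually_elim simp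
    qed (intro borel_measurable_times hm h'm E)+
    then show "frft_L1 \<alpha> h u = frft_L1 \<alpha> h' u" by (simp add: frft_L1_lebesgue)
  qed
  ultimately show ?thesis using that ae' by blast
qed

lemma integrable_mult_chirp:
  assumes "integrable lborel f"
  shows "integrable lborel (\<lambda>x. f x * chirp \<alpha> x)"
proof -
  note [measurable] = integrable_borelD[OF assms]
  show ?thesis by (rule Bochner_Integration.integrable_bound[OF assms]) (auto simp: norm_mult)
qed

lemma frft_L1_diff:
  assumes "integrable lebesgue a" "integrable lebesgue b"
  shows "frft_L1 \<alpha> (\<lambda>x. a x - b x) u = frft_L1 \<alpha> a u - frft_L1 \<alpha> b u"
proof -
  have E: "(\<lambda>x. chirp \<alpha> x * cis (- (x \<bullet> csc_scale \<alpha> u))) \<in> borel_measurable lebesgue"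
    by (rule measurable_completion) simp
  have "integrable lebesgue (\<lambda>x. f x * (chirp \<alpha> x * cis (- (x \<bullet> csc_scale \<alpha> u))))" if f: "integrable lebesgue f" for f
    by (rule Bochner_Integration.integrable_bound[OF f])
       (use f in \<open>auto simp: norm_mult intro!: borel_measurable_times E\<close>)
  note this[OF assms(1)] this[OF assms(2)]
  then show ?thesis
    by (simp add: frft_L1_lebesgue mult.assoc left_diff_distrib right_diff_distrib)
qed

lemma frft_L1_plancherel_le:
  fixes \<alpha> :: "real^'n"
  assumes \<alpha>: "\<And>k. sin (\<alpha> $ k) \<noteq> 0"
  obtains C :: real where "C \<ge> 0"
    "\<And>h. integrable lebesgue h \<Longrightarrow>
      (\<integral>\<^sup>+u. ennreal ((cmod (frft_L1 \<alpha> h u))\<^sup>2) \<partial>lebesgue) \<le> ennreal C * (\<integral>\<^sup>+x. ennreal ((cmod (h x))\<^sup>2) \<partial>lebesgue)"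
proof -
  obtain J where J: "J \<ge> 0" "\<And>F. F \<in> borel_measurable borel \<Longrightarrow>
      (\<integral>\<^sup>+u. F (csc_scale \<alpha> u) \<partial>lborel) = ennreal J * (\<integral>\<^sup>+\<xi>. F \<xi> \<partial>lborel)"
    using nn_integral_csc_scale[OF \<alpha>] by blast
  define c where "c = (cmod (frft_factor \<alpha>))\<^sup>2"
  define N where "N = (2 * pi) ^ DIM(real^'n)"
  show ?thesis
  proof (rule that[of "c * J * N"])
    show "c * J * N \<ge> 0" using J by (simp add: c_def N_def)
    fix h :: "real^'n \<Rightarrow> complex" assume "integrable lebesgue h"
    then obtain h' where h': "integrable lborel h'" and ae: "AE x in lebesgue. h x = h' x" and eq: "frft_L1 \<alpha> h = frft_L1 \<alpha> h'"
      by (rule integrable_lebesgue_borel_version)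
    note [measurable] = integrable_borelD[OF h']
    have "(\<integral>\<^sup>+u. ennreal ((cmod (frft_L1 \<alpha> h u))\<^sup>2) \<partial>lebesgue) =
        (\<integral>\<^sup>+u. ennreal c * ennreal ((cmod (fourier (\<lambda>x. h' x * chirp \<alpha> x) (csc_scale \<alpha> u)))\<^sup>2) \<partial>lborel)"
      unfolding nn_integral_completion eq
      by (simp add: frft_L1_eq_fourier norm_mult power_mult_distrib c_def ennreal_mult)
    also have "\<dots> = ennreal c * (ennreal J * (\<integral>\<^sup>+\<xi>. ennreal ((cmod (fourier (\<lambda>x. h' x * chirp \<alpha> x) \<xi>))\<^sup>2) \<partial>lborel))"
      by (simp add: nn_integral_cmult J(2)[of "\<lambda>\<xi>. ennreal ((cmod (fourier (\<lambda>x. h' x * chirp \<alpha> x) \<xi>))\<^sup>2)"])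
    also have "\<dots> \<le> ennreal c * (ennreal J * (ennreal N * (\<integral>\<^sup>+x. ennreal ((cmod (h' x * chirp \<alpha> x))\<^sup>2) \<partial>lborel)))"
      unfolding N_def by (intro mult_left_mono plancherel_le integrable_mult_chirp h') simp_all
    also have "(\<integral>\<^sup>+x. ennreal ((cmod (h' x * chirp \<alpha> x))\<^sup>2) \<partial>lborel) = (\<integral>\<^sup>+x. ennreal ((cmod (h x))\<^sup>2) \<partial>lebesgue)"
    proof -
      have "AE x in lebesgue. ennreal ((cmod (h' x * chirp \<alpha> x))\<^sup>2) = ennreal ((cmod (h x))\<^sup>2)"
        using ae by eventually_elim (simp add: norm_mult)
      from nn_integral_cong_AE[OF this] show ?thesis
        by (simp only: nn_integral_completion)
    qed
    finally show "(\<integral>\<^sup>+u. ennreal ((cmod (frft_L1 \<alpha> h u))\<^sup>2) \<partial>lebesgue) \<le> ennreal (c * J * N) * (\<integral>\<^sup>+x. ennreal ((cmod (h x))\<^sup>2) \<partial>lebesgue)"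
      using J by (simp add: ennreal_mult c_def N_def mult.assoc)
  qed
qed

lemma square_integrable_iff_nn_integral:
  "square_integrable f \<longleftrightarrow> f \<in> borel_measurable lebesgue \<and> (\<integral>\<^sup>+x. ennreal ((cmod (f x))\<^sup>2) \<partial>lebesgue) < \<infinity>"
proof (cases "f \<in> borel_measurable lebesgue")
  case True
  then have "(\<lambda>x. (cmod (f x))\<^sup>2) \<in> borel_measurable lebesgue" by measurable
  with True show ?thesis by (simp add: square_integrable_def integrable_iff_bounded)
qed (simp add: square_integrable_def)

text \<open>
If two sequences approximate \<open>f\<close> in \<open>L\<^sup>2\<close>, their difference tends to zero in \<open>L\<^sup>2\<close>, and by the
Plancherel inequality so does the difference of the transforms.
\<close>

lemma is_frft_L2_unique:
  fixes \<alpha> :: "real^'n"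
  assumes \<alpha>: "\<And>k. sin (\<alpha> $ k) \<noteq> 0" and G: "is_frft_L2 \<alpha> f G" and G': "is_frft_L2 \<alpha> f G'"
  shows "AE u in lebesgue. G u = G' u"
proof -
  obtain C where C: "C \<ge> 0" "\<And>h. integrable lebesgue h \<Longrightarrow>
      (\<integral>\<^sup>+u. ennreal ((cmod (frft_L1 \<alpha> h u))\<^sup>2) \<partial>lebesgue) \<le> ennreal C * (\<integral>\<^sup>+x. ennreal ((cmod (h x))\<^sup>2) \<partial>lebesgue)"
    using frft_L1_plancherel_le[OF \<alpha>] by blast
  obtain a where a: "\<And>m. integrable lebesgue (a m)" "L2_tendsto a f" "L2_tendsto (\<lambda>m. frft_L1 \<alpha> (a m)) G"
    using G unfolding is_frft_L2_def by blast
  obtain b where b: "\<And>m. integrable lebesgue (b m)" "L2_tendsto b f" "L2_tendsto (\<lambda>m. frft_L1 \<alpha> (b m)) G'"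
    using G' unfolding is_frft_L2_def by blast
  have [measurable]: "f \<in> borel_measurable lebesgue" "G \<in> borel_measurable lebesgue" "G' \<in> borel_measurable lebesgue"
    using G G' by (auto simp: is_frft_L2_def square_integrable_def)
  have [measurable]: "a m \<in> borel_measurable lebesgue" "b m \<in> borel_measurable lebesgue" for m
    using a(1) b(1) by auto
  have Fm: "frft_L1 \<alpha> h \<in> borel_measurable lebesgue" if h: "integrable lebesgue h" for h
  proof -
    obtain h' where "integrable lborel h'" "frft_L1 \<alpha> h = frft_L1 \<alpha> h'"
      using integrable_lebesgue_borel_version[OF h] by metis
    then show ?thesis by (simp add: borel_measurable_lebesgueI measurable_frft_L1 integrable_borelD)
  qed
  note [measurable] = Fm[OF a(1)] Fm[OF b(1)]
  define A B A' B' where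
    "A = (\<lambda>m. \<integral>\<^sup>+x. ennreal ((cmod (a m x - f x))\<^sup>2) \<partial>lebesgue)" and
    "B = (\<lambda>m. \<integral>\<^sup>+x. ennreal ((cmod (b m x - f x))\<^sup>2) \<partial>lebesgue)" and
    "A' = (\<lambda>m. \<integral>\<^sup>+x. ennreal ((cmod (frft_L1 \<alpha> (a m) x - G x))\<^sup>2) \<partial>lebesgue)" and
    "B' = (\<lambda>m. \<integral>\<^sup>+x. ennreal ((cmod (frft_L1 \<alpha> (b m) x - G' x))\<^sup>2) \<partial>lebesgue)"
  have lim: "A \<longlonglongrightarrow> 0" "B \<longlonglongrightarrow> 0" "A' \<longlonglongrightarrow> 0" "B' \<longlonglongrightarrow> 0"
    using a b by (simp_all add: L2_tendsto_def A_def B_def A'_def B'_def)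
  let ?Q = "\<integral>\<^sup>+u. ennreal ((cmod (G u - G' u))\<^sup>2) \<partial>lebesgue"
  have bound: "?Q \<le> 2 * A' m + 2 * (2 * (ennreal C * (2 * A m + 2 * B m)) + 2 * B' m)" for m
  proof -
    have "?Q \<le> 2 * (\<integral>\<^sup>+u. ennreal ((cmod (G u - frft_L1 \<alpha> (a m) u))\<^sup>2) \<partial>lebesgue) +
        2 * (\<integral>\<^sup>+u. ennreal ((cmod (frft_L1 \<alpha> (a m) u - G' u))\<^sup>2) \<partial>lebesgue)"
      by (rule nn_integral_square_triangle) measurable
    also have "(\<integral>\<^sup>+u. ennreal ((cmod (G u - frft_L1 \<alpha> (a m) u))\<^sup>2) \<partial>lebesgue) = A' m"
      by (simp add: A'_def norm_minus_commute)
    also have "(\<integral>\<^sup>+u. ennreal ((cmod (frft_L1 \<alpha> (a m) u - G' u))\<^sup>2) \<partial>lebesgue) \<le>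
        2 * (\<integral>\<^sup>+u. ennreal ((cmod (frft_L1 \<alpha> (a m) u - frft_L1 \<alpha> (b m) u))\<^sup>2) \<partial>lebesgue) + 2 * B' m"
      unfolding B'_def by (rule nn_integral_square_triangle) measurable
    also have "(\<integral>\<^sup>+u. ennreal ((cmod (frft_L1 \<alpha> (a m) u - frft_L1 \<alpha> (b m) u))\<^sup>2) \<partial>lebesgue) \<le>
        ennreal C * (\<integral>\<^sup>+x. ennreal ((cmod (a m x - b m x))\<^sup>2) \<partial>lebesgue)"
      unfolding frft_L1_diff[OF a(1) b(1), symmetric] by (intro C(2) Bochner_Integration.integrable_diff a b)
    also have "(\<integral>\<^sup>+x. ennreal ((cmod (a m x - b m x))\<^sup>2) \<partial>lebesgue) \<le>
        2 * A m + 2 * (\<integral>\<^sup>+x. ennreal ((cmod (f x - b m x))\<^sup>2) \<partial>lebesgue)"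
      unfolding A_def by (rule nn_integral_square_triangle) measurable
    also have "(\<integral>\<^sup>+x. ennreal ((cmod (f x - b m x))\<^sup>2) \<partial>lebesgue) = B m"
      by (simp add: B_def norm_minus_commute)
    finally show ?thesis by (simp add: mult_left_mono add_mono)
  qed
  have "(\<lambda>m. 2 * A' m + 2 * (2 * (ennreal C * (2 * A m + 2 * B m)) + 2 * B' m)) \<longlonglongrightarrow>
      2 * 0 + 2 * (2 * (ennreal C * (2 * 0 + 2 * 0)) + 2 * 0)"
    by (intro tendsto_add tendsto_mult_ennreal tendsto_const lim) auto
  then have "?Q \<le> 2 * 0 + 2 * (2 * (ennreal C * (2 * 0 + 2 * 0)) + 2 * 0)"
    by (rule tendsto_lowerbound) (use bound in auto)
  then have "?Q = 0" by simp
  moreover have "(\<lambda>u. ennreal ((cmod (G u - G' u))\<^sup>2)) \<in> borel_measurable lebesgue" by measurable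
  ultimately have "AE u in lebesgue. ennreal ((cmod (G u - G' u))\<^sup>2) = 0"
    using nn_integral_0_iff_AE by blast
  then show ?thesis by eventually_elim simp
qed

text \<open>
This treats the two branches of the definition of \<open>frft\<close> alike: an integrable \<open>f\<close> is approximated
by the constant sequence, so that its \<open>L\<^sup>1\<close> transform is an \<open>L\<^sup>2\<close> transform as well.
\<close>

lemma frft_eq_of_is_frft_L2:
  fixes \<alpha> :: "real^'n"
  assumes \<alpha>: "\<And>k. sin (\<alpha> $ k) \<noteq> 0" and G: "is_frft_L2 \<alpha> f G"
  shows "AE u in lebesgue. frft \<alpha> f u = G u"
proof (cases "integrable lebesgue f")
  case True
  obtain C where C: "C \<ge> 0" "\<And>h. integrable lebesgue h \<Longrightarrow>
      (\<integral>\<^sup>+u. ennreal ((cmod (frft_L1 \<alpha> h u))\<^sup>2) \<partial>lebesgue) \<le> ennreal C * (\<integral>\<^sup>+x. ennreal ((cmod (h x))\<^sup>2) \<partial>lebesgue)"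
    using frft_L1_plancherel_le[OF \<alpha>] by blast
  have sq: "square_integrable f" using G by (simp add: is_frft_L2_def)
  obtain f' where f': "integrable lborel f'" "frft_L1 \<alpha> f = frft_L1 \<alpha> f'"
    using integrable_lebesgue_borel_version[OF True] by metis
  have "square_integrable (frft_L1 \<alpha> f)"
    unfolding square_integrable_iff_nn_integral
  proof
    show "frft_L1 \<alpha> f \<in> borel_measurable lebesgue"
      using f' by (simp add: borel_measurable_lebesgueI measurable_frft_L1 integrable_borelD)
    show "(\<integral>\<^sup>+u. ennreal ((cmod (frft_L1 \<alpha> f u))\<^sup>2) \<partial>lebesgue) < \<infinity>"
      using le_less_trans[OF C(2)[OF True]] sq by (simp add: square_integrable_iff_nn_integral ennreal_mult_less_top)
  qed
  then have "is_frft_L2 \<alpha> f (frft_L1 \<alpha> f)"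
    unfolding is_frft_L2_def using True sq by (auto intro!: exI[of _ "\<lambda>_. f"] simp: L2_tendsto_def)
  from is_frft_L2_unique[OF \<alpha> this G] show ?thesis using True by (simp add: frft_def)
next
  case False
  have "is_frft_L2 \<alpha> f (frft_L2 \<alpha> f)" unfolding frft_L2_def by (rule someI[of "is_frft_L2 \<alpha> f", OF G])
  from is_frft_L2_unique[OF \<alpha> this G] show ?thesis using False by (simp add: frft_def)
qed

section \<open>The fractional Riesz transform of a Schwartz function\<close>

lemma schwartz_differentiable:
  assumes "schwartz f"
  shows "f differentiable (at x)"
proof -
  have "iter_partial_deriv [] f differentiable (at x)"
    using assms unfolding schwartz_def by blast
  then show ?thesis by (simp add: iter_partial_deriv_def)
qed

lemma schwartz_bounded:
  assumes "schwartz f"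
  obtains B where "\<And>x. \<bar>\<Prod>k\<in>UNIV. (x $ k) ^ \<beta> k\<bar> * cmod (f x) \<le> B"
proof -
  have "bounded (range (\<lambda>x. complex_of_real (\<Prod>k\<in>UNIV. (x $ k) ^ \<beta> k) * iter_partial_deriv [] f x))"
    using assms unfolding schwartz_def by blast
  then obtain B where "cmod (complex_of_real (\<Prod>k\<in>UNIV. (x $ k) ^ \<beta> k) * f x) \<le> B" for x
    by (auto simp: bounded_iff iter_partial_deriv_def)
  then show ?thesis using that unfolding norm_mult norm_of_real by blast
qed

text \<open>
Expanding \<open>\<Prod>\<^sub>k (1 + x\<^sub>k\<^sup>2)\<close> into monomials shows that this product times \<open>|f x|\<close> is bounded, and
\<open>\<Prod>\<^sub>k 1 / (1 + x\<^sub>k\<^sup>2)\<close> is integrable coordinate by coordinate.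
\<close>

lemma schwartz_integrable:
  fixes f :: "real^'n \<Rightarrow> complex"
  assumes f: "schwartz f"
  shows "integrable lborel f"
proof -
  have cont: "continuous_on UNIV f"
    using schwartz_differentiable[OF f] by (simp add: continuous_on_eq_continuous_at differentiable_imp_continuous_within)
  have [measurable]: "f \<in> borel_measurable borel" by (rule borel_measurable_continuous_onI[OF cont])
  have "\<exists>B. \<forall>x. (\<Prod>k\<in>S. (x $ k)\<^sup>2) * cmod (f x) \<le> B" for S :: "'n set"
  proof -
    obtain B where B: "\<And>x. \<bar>\<Prod>k\<in>UNIV. (x $ k) ^ (if k \<in> S then 2 else 0)\<bar> * cmod (f x) \<le> B"
      using schwartz_bounded[OF f, of "\<lambda>k. if k \<in> S then 2 else 0"] by blast
    have "\<bar>\<Prod>k\<in>UNIV. (x $ k) ^ (if k \<in> S then 2 else 0)\<bar> = (\<Prod>k\<in>S. (x $ k)\<^sup>2)" for x :: "real^'n"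
      by (simp add: if_distrib prod.If_cases prod_nonneg cong: if_cong)
    then show ?thesis using B by auto
  qed
  then obtain B where B: "\<And>S x. (\<Prod>k\<in>S. (x $ k)\<^sup>2) * cmod (f x) \<le> B S" by metis
  define C where "C = (\<Sum>S\<in>UNIV. B S)"
  have poly: "(\<Prod>k\<in>UNIV. (1 + (x $ k)\<^sup>2)) * cmod (f x) \<le> C" for x
  proof -
    have "(\<Prod>k\<in>UNIV. ((x $ k)\<^sup>2 + 1)) = (\<Sum>S\<in>UNIV. \<Prod>k\<in>S. (x $ k)\<^sup>2)"
      using prod_add[of "UNIV :: 'n set" "\<lambda>k. (x $ k)\<^sup>2" "\<lambda>k. 1"] by simp
    then have "(\<Prod>k\<in>UNIV. (1 + (x $ k)\<^sup>2)) * cmod (f x) = (\<Sum>S\<in>UNIV. (\<Prod>k\<in>S. (x $ k)\<^sup>2) * cmod (f x))"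
      by (simp add: add.commute sum_distrib_right)
    also have "\<dots> \<le> C" unfolding C_def by (intro sum_mono B)
    finally show ?thesis .
  qed
  have i1: "integrable lborel (\<lambda>t::real. complex_of_real (inverse (1 + t\<^sup>2)))"
    using integrable_inverse_1_plus_square unfolding complex_of_real_integrable_eq
    by (simp add: set_integrable_def einterval_def)
  have "integrable lborel (\<lambda>x::real^'n. \<Prod>b\<in>Basis. complex_of_real (inverse (1 + (x \<bullet> b)\<^sup>2)))"
    by (rule integrable_lborel_prod[OF i1])
  moreover have "(\<Prod>b\<in>Basis. complex_of_real (inverse (1 + (x \<bullet> b)\<^sup>2))) = complex_of_real (inverse (\<Prod>k\<in>UNIV. (1 + (x $ k)\<^sup>2)))"
    for x :: "real^'n"
  proof -
    have B: "(Basis :: (real^'n) set) = (\<lambda>k. axis k 1) ` UNIV" by (auto simp: Basis_vec_def)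
    have "inj (\<lambda>k::'n. axis k (1::real))" by (auto simp: inj_on_def axis_eq_axis)
    then show ?thesis unfolding B by (simp add: prod.reindex inner_axis prod_inversef[symmetric] o_def)
  qed
  ultimately have "integrable lborel (\<lambda>x::real^'n. C * inverse (\<Prod>k\<in>UNIV. (1 + (x $ k)\<^sup>2)))"
    by (simp only: complex_of_real_integrable_eq integrable_mult_right)
  then show ?thesis
  proof (rule Bochner_Integration.integrable_bound)
    have "cmod (f x) \<le> norm (C * inverse (\<Prod>k\<in>UNIV. (1 + (x $ k)\<^sup>2)))" for x
    proof -
      have "(\<Prod>k\<in>UNIV. (1 + (x $ k)\<^sup>2)) > 0" by (intro prod_pos) (auto intro: add_pos_nonneg)
      then have "cmod (f x) \<le> C * inverse (\<Prod>k\<in>UNIV. (1 + (x $ k)\<^sup>2))"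
        using poly[of x] by (simp add: field_simps)
      then show ?thesis by simp
    qed
    then show "AE x in lborel. norm (f x) \<le> norm (C * inverse (\<Prod>k\<in>UNIV. (1 + (x $ k)\<^sup>2)))" by simp
  qed simp
qed

lemma frac_riesz_eq:
  fixes f :: "real^'n \<Rightarrow> complex"
  assumes g: "integrable lborel (\<lambda>x. f x * chirp \<alpha> x)" and M: "\<And>x. cmod (f x * chirp \<alpha> x) \<le> M"
    and diff: "\<And>x. (\<lambda>x. f x * chirp \<alpha> x) differentiable (at x)" 
  shows "frac_riesz j \<alpha> f x = chirp (- \<alpha>) x * riesz_transform (axis j 1) (\<lambda>x. f x * chirp \<alpha> x) x"
proof -
  let ?g = "\<lambda>x. f x * chirp \<alpha> x"
  let ?R = "riesz_transform (axis j 1) ?g x"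
  have e: "axis j (1::real) \<in> Basis" by (auto simp: Basis_vec_def)
  have [measurable]: "?g \<in> borel_measurable borel" by (rule integrable_borelD[OF g])
  define c where "c = complex_of_real (riesz_const CARD('n))"
  have c: "c \<noteq> 0" by (simp add: c_def riesz_const_def Gamma_real_pos less_imp_neq[symmetric])
  let ?F = "\<lambda>\<epsilon>. LINT y:{y. \<epsilon> \<le> norm (x - y)}|lebesgue.
      complex_of_real ((x $ j - y $ j) / norm (x - y) ^ (CARD('n) + 1)) * f y * chirp \<alpha> y"
  let ?P = "\<lambda>\<epsilon>. LINT y|lborel. indicator {y. \<epsilon> \<le> norm (x - y)} y *\<^sub>R (riesz_kernel (axis j 1) (x - y) * ?g y)"
  have [measurable]: "{y. \<epsilon> \<le> norm (x - y)} \<in> sets borel" for \<epsilon> by measurable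
  have F: "?F \<epsilon> = ?P \<epsilon> / c" for \<epsilon>
  proof -
    have "?P \<epsilon> = c * (LINT y|lborel. indicator {y. \<epsilon> \<le> norm (x - y)} y *\<^sub>R
        (complex_of_real ((x $ j - y $ j) / norm (x - y) ^ (CARD('n) + 1)) * ?g y))"
      unfolding integral_mult_right_zero[symmetric]
      by (intro Bochner_Integration.integral_cong refl)
         (simp add: riesz_kernel_def c_def inner_axis scaleR_conv_of_real mult_ac)
    also have "(LINT y|lborel. indicator {y. \<epsilon> \<le> norm (x - y)} y *\<^sub>R
        (complex_of_real ((x $ j - y $ j) / norm (x - y) ^ (CARD('n) + 1)) * ?g y)) = ?F \<epsilon>"
      unfolding set_lebesgue_integral_def mult.assoc
      by (rule integral_completion[symmetric]) simp
    finally show ?thesis using c by simp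
  qed
  have "(?F \<longlongrightarrow> ?R / c) (at_right 0)"
    unfolding F by (intro tendsto_divide tendsto_const riesz_principal_value[OF e g M diff] c)
  then have "Lim (at_right 0) ?F = ?R / c"
    by (intro tendsto_Lim) simp_all
  then show ?thesis using c by (simp add: frac_riesz_def c_def)
qed

theorem theorem2p1:
  fixes \<alpha> :: "real^'n" and j :: 'n and f :: "real^'n \<Rightarrow> complex"
  assumes "\<forall>k. \<forall>m::int. \<alpha> $ k \<noteq> of_int m * pi"
    and "schwartz f"
  shows "AE u in lebesgue.
    frft \<alpha> (frac_riesz j \<alpha> f) u =
      - \<i> * complex_of_real (csc_scale \<alpha> u $ j / norm (csc_scale \<alpha> u)) * frft \<alpha> f u"
proof -
  have \<alpha>: "sin (\<alpha> $ k) \<noteq> 0" for k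
    using assms(1) by (auto simp: sin_zero_iff_int2)
  define e where "e = axis j (1::real)"
  have e: "e \<in> Basis" by (auto simp: Basis_vec_def e_def)
  define g where "g = (\<lambda>x. f x * chirp \<alpha> x)"
  note f = schwartz_integrable[OF assms(2)]
  have g: "integrable lborel g" unfolding g_def by (rule integrable_mult_chirp[OF f])
  obtain M where fM: "\<And>x. cmod (f x) \<le> M"
    using schwartz_bounded[OF assms(2), of "\<lambda>_. 0"] by auto
  then have M: "cmod (g x) \<le> M" for x by (simp add: g_def norm_mult)
  have diff: "g differentiable (at x)" for x
    unfolding g_def by (intro differentiable_mult schwartz_differentiable assms chirp_differentiable)
  have [measurable]: "f \<in> borel_measurable borel" "g \<in> borel_measurable borel"
    using f g by (auto intro: integrable_borelD)
  have R: "frac_riesz j \<alpha> f = (\<lambda>x. chirp (- \<alpha>) x * riesz_transform e g x)"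
    using frac_riesz_eq[OF g[unfolded g_def] M[unfolded g_def] diff[unfolded g_def]] by (simp add: g_def e_def fun_eq_iff)
  define h where "h = (\<lambda>m. convol (\<lambda>y. complex_of_real (riesz_trunc m e y)) g)"
  have ih: "integrable lborel (h m)" for m
    unfolding h_def by (intro integrable_convol integrable_riesz_trunc e g)
  have [measurable]: "h m \<in> borel_measurable borel" for m by (rule integrable_borelD[OF ih])
  define H where "H = (\<lambda>m x. chirp (- \<alpha>) x * h m x)"
  have [measurable]: "H m \<in> borel_measurable borel" for m unfolding H_def by measurable
  have Hh: "(\<lambda>x. H m x * chirp \<alpha> x) = h m" for m
    using chirp_minus_mult[of \<alpha>] by (simp add: H_def fun_eq_iff mult.commute mult.left_commute)
  have iH: "integrable lborel (H m)" for m
    using integrable_mult_chirp[OF ih, of m "- \<alpha>"] by (simp add: H_def mult.commute)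
  obtain C where C: "C \<ge> 0" "\<And>h. integrable lebesgue h \<Longrightarrow>
      (\<integral>\<^sup>+u. ennreal ((cmod (frft_L1 \<alpha> h u))\<^sup>2) \<partial>lebesgue) \<le> ennreal C * (\<integral>\<^sup>+x. ennreal ((cmod (h x))\<^sup>2) \<partial>lebesgue)"
    using frft_L1_plancherel_le[OF \<alpha>] by blast
  obtain J where J: "J \<ge> 0" "\<And>F. F \<in> borel_measurable borel \<Longrightarrow>
      (\<integral>\<^sup>+u. F (csc_scale \<alpha> u) \<partial>lborel) = ennreal J * (\<integral>\<^sup>+\<xi>. F \<xi> \<partial>lborel)"
    using nn_integral_csc_scale[OF \<alpha>] by blast
  \<comment> \<open>G is the claimed transform; H is the sequence in the definition of the extension that produces it.\<close>
  define G where "G = (\<lambda>u. riesz_mult e (csc_scale \<alpha> u) * frft_L1 \<alpha> f u)"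
  have [measurable]: "frft_L1 \<alpha> f \<in> borel_measurable borel" by (rule measurable_frft_L1) simp
  have [measurable]: "G \<in> borel_measurable borel" unfolding G_def by measurable
  have fleb: "integrable lebesgue f" using f by (simp add: integrable_completion)
  have sqH: "square_integrable (H m)" for m
  proof -
    have cont: "continuous_on UNIV g"
      using diff by (simp add: continuous_on_eq_continuous_at differentiable_imp_continuous_within)
    have "cmod (H m x) \<le> M * (LINT y|lborel. cmod (complex_of_real (riesz_trunc m e y)))" for x
      using norm_convol_le[OF integrable_riesz_trunc[OF e] cont M] by (simp add: H_def h_def norm_mult)
    from nn_integral_square_finite_of_bounded[OF iH this] show ?thesis
      by (simp add: square_integrable_iff_nn_integral borel_measurable_lebesgueI nn_integral_completion)
  qed
  have sqG: "square_integrable G"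
    unfolding square_integrable_iff_nn_integral
  proof
    have "(cmod (G u))\<^sup>2 \<le> (cmod (frft_L1 \<alpha> f u))\<^sup>2" for u
      using norm_riesz_mult_le[OF e] by (intro power_mono) (auto simp: G_def norm_mult intro!: mult_left_le_one_le)
    then have "(\<integral>\<^sup>+u. ennreal ((cmod (G u))\<^sup>2) \<partial>lebesgue) \<le> (\<integral>\<^sup>+u. ennreal ((cmod (frft_L1 \<alpha> f u))\<^sup>2) \<partial>lebesgue)"
      by (intro nn_integral_mono ennreal_leI)
    also have "\<dots> \<le> ennreal C * (\<integral>\<^sup>+x. ennreal ((cmod (f x))\<^sup>2) \<partial>lebesgue)" by (rule C(2)[OF fleb])
    also have "\<dots> < \<infinity>"
      using nn_integral_square_finite_of_bounded[OF fleb fM] by (simp add: ennreal_mult_less_top)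
    finally show "(\<integral>\<^sup>+u. ennreal ((cmod (G u))\<^sup>2) \<partial>lebesgue) < \<infinity>" .
  qed (simp add: borel_measurable_lebesgueI)
  have limH: "L2_tendsto H (frac_riesz j \<alpha> f)"
  proof -
    have "cmod (H m x - frac_riesz j \<alpha> f x) = cmod (h m x - riesz_transform e g x)" for m x
      unfolding R H_def right_diff_distrib[symmetric] by (simp add: norm_mult)
    then show ?thesis
      unfolding L2_tendsto_def nn_integral_completion using convol_riesz_trunc_L2[OF e g M diff] by (simp add: h_def)
  qed
  have [measurable]: "frac_riesz j \<alpha> f \<in> borel_measurable borel" unfolding R by measurable
  have sqR: "square_integrable (frac_riesz j \<alpha> f)"
    unfolding square_integrable_iff_nn_integral
  proof
    let ?D = "\<lambda>m. \<integral>\<^sup>+x. ennreal ((cmod (H m x - frac_riesz j \<alpha> f x))\<^sup>2) \<partial>lebesgue"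
    have "\<forall>\<^sub>F m in sequentially. ?D m < 1"
      using limH unfolding L2_tendsto_def by (rule order_tendstoD) simp
    then obtain m where m: "?D m < 1" by (auto simp: eventually_sequentially)
    have "(\<integral>\<^sup>+x. ennreal ((cmod (0 - frac_riesz j \<alpha> f x))\<^sup>2) \<partial>lebesgue) \<le>
        2 * (\<integral>\<^sup>+x. ennreal ((cmod (0 - H m x))\<^sup>2) \<partial>lebesgue) + 2 * ?D m"
      by (rule nn_integral_square_triangle) (simp_all add: borel_measurable_lebesgueI)
    also have "\<dots> < \<infinity>"
      using sqH[of m] less_trans[OF m] by (simp add: square_integrable_iff_nn_integral ennreal_mult_less_top)
    finally show "(\<integral>\<^sup>+x. ennreal ((cmod (frac_riesz j \<alpha> f x))\<^sup>2) \<partial>lebesgue) < \<infinity>" by simp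
  qed (simp add: borel_measurable_lebesgueI)
  have limF: "L2_tendsto (\<lambda>m. frft_L1 \<alpha> (H m)) G"
  proof -
    let ?d = "\<lambda>m \<xi>. ennreal ((cmod (fourier (h m) \<xi> - riesz_mult e \<xi> * fourier g \<xi>))\<^sup>2)"
    let ?c = "ennreal ((cmod (frft_factor \<alpha>))\<^sup>2)"
    have "(\<integral>\<^sup>+u. ennreal ((cmod (frft_L1 \<alpha> (H m) u - G u))\<^sup>2) \<partial>lebesgue) = ?c * (ennreal J * (\<integral>\<^sup>+\<xi>. ?d m \<xi> \<partial>lborel))" for m
    proof -
      have "frft_L1 \<alpha> (H m) u - G u = frft_factor \<alpha> * chirp \<alpha> u *
          (fourier (h m) (csc_scale \<alpha> u) - riesz_mult e (csc_scale \<alpha> u) * fourier g (csc_scale \<alpha> u))" for u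
        by (simp add: frft_L1_eq_fourier G_def Hh g_def right_diff_distrib mult.left_commute)
      then have "ennreal ((cmod (frft_L1 \<alpha> (H m) u - G u))\<^sup>2) = ?c * ?d m (csc_scale \<alpha> u)" for u
        by (simp add: norm_mult power_mult_distrib ennreal_mult)
      then show ?thesis
        unfolding nn_integral_completion by (simp add: nn_integral_cmult J(2)[of "?d m"])
    qed
    moreover have "(\<lambda>m. ?c * (ennreal J * (\<integral>\<^sup>+\<xi>. ?d m \<xi> \<partial>lborel))) \<longlonglongrightarrow> ?c * (ennreal J * 0)"
      unfolding h_def by (intro tendsto_mult_ennreal tendsto_const fourier_convol_riesz_trunc_L2[OF e g M]) auto
    ultimately show ?thesis unfolding L2_tendsto_def by simp
  qed
  have "is_frft_L2 \<alpha> (frac_riesz j \<alpha> f) G"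
    unfolding is_frft_L2_def
    using sqR sqG sqH iH limH limF by (auto intro!: exI[of _ H] simp: integrable_completion)
  from frft_eq_of_is_frft_L2[OF \<alpha> this]
  have "AE u in lebesgue. frft \<alpha> (frac_riesz j \<alpha> f) u = G u" .
  then show ?thesis
  proof eventually_elim
    case (elim u)
    then show ?case
      using fleb by (simp add: G_def frft_def riesz_mult_def e_def inner_axis)
  qed
qed

end
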